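(* Let $U$ be a finite set and $\alpha,\beta\in(0,1]$. There is an algorithm which, for any submodular function $f\colon 2^U\to[0,1]$ and any product distribution $\mathcal{D}$ over $2^U$, runs in time $|U|^{O(\alpha^{-2}\log(1/\beta))}$, accesses $f$ only through oracle queries of tolerance $\alpha^2/(72\log(1/\beta))$, and outputs a function $h$ that $(\alpha,\beta)$-approximates $f$ over $\mathcal{D}$.
   Context: A function $f\colon 2^U\to\mathbb{R}$ is submodular if $f(S\cup T)+f(S\cap T)\le f(S)+f(T)$ for all $S,T\subseteq U$ (not necessarily monotone). A product distribution over $2^U$ is a distribution of a random set in which each $x\in U$ is included independently with some probability. An oracle query of tolerance $\tau$ on $S$ returns a value within $\tau$ of $f(S)$. A function $h$ $(\alpha,\beta)$-approximates $f$ over $\mathcal{D}$ if $\Pr_{S\sim\mathcal{D}}\{|f(S)-h(S)|\le\alpha\}\ge1-\beta$.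
   Formalization: For β>1/2, log(1/β) is replaced by log 2 in the tolerance and time, as the claim fails for β near 1; the algorithm is randomized, h being an (α,β)-approximation with probability at least 1−δ for any fixed δ>0, the O-constant depending on δ. *)

theory Defs
  imports "HOL-Probability.Product_PMF"
begin

section \<open>Submodular functions, product distributions, approximation\<close>

definition submodular_on :: "'a set \<Rightarrow> ('a set \<Rightarrow> real) \<Rightarrow> bool" where
  "submodular_on U f \<longleftrightarrow>
     (\<forall>S T. S \<subseteq> U \<longrightarrow> T \<subseteq> U \<longrightarrow> f (S \<union> T) + f (S \<inter> T) \<le> f S + f T)"

definition product_distribution :: "'a set \<Rightarrow> ('a \<Rightarrow> real) \<Rightarrow> 'a set pmf" where
  "product_distribution U p =
     map_pmf (\<lambda>b. {x \<in> U. b x}) (Pi_pmf U False (\<lambda>x. bernoulli_pmf (p x)))"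

definition approximates ::
  "'a set pmf \<Rightarrow> real \<Rightarrow> real \<Rightarrow> ('a set \<Rightarrow> real) \<Rightarrow> ('a set \<Rightarrow> real) \<Rightarrow> bool" where
  "approximates D \<alpha> \<beta> f h \<longleftrightarrow> measure_pmf.prob D {S. \<bar>f S - h S\<bar> \<le> \<alpha>} \<ge> 1 - \<beta>"

text \<open>
  The quantity \<open>log (1/\<beta>)\<close>, with the convention that it is frozen at its value for \<open>\<beta> = 1/2\<close>
  when \<open>\<beta> > 1/2\<close>. As \<open>\<beta>\<close> tends to 1 the plain logarithm tends to 0, so that a tolerance
  \<open>\<alpha>\<^sup>2 / (72 log (1/\<beta>))\<close> exceeds 1/2 and the oracle may give the same answer for every function
  with values in \<open>[0,1]\<close>.
\<close>

definition log_inv :: "real \<Rightarrow> real" where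
  "log_inv \<beta> = ln (1 / min \<beta> (1/2))"

section \<open>Oracles\<close>

text \<open>
  The answer may depend on the earlier queries (latest first), so repeating a query need not give
  the same value twice, and answers may be chosen adversarially within the tolerance.
\<close>

type_synonym 'a answers = "'a set list \<Rightarrow> 'a set \<Rightarrow> real"

definition tolerant_oracle :: "'a set \<Rightarrow> ('a set \<Rightarrow> real) \<Rightarrow> real \<Rightarrow> 'a answers \<Rightarrow> bool" where
  "tolerant_oracle U f \<tau> orc \<longleftrightarrow> (\<forall>qs S. S \<subseteq> U \<longrightarrow> \<bar>orc qs S - f S\<bar> \<le> \<tau>)"

section \<open>A randomized real RAM with oracle queries\<close>

text \<open>
  The machine has a memory of natural numbers (addition, truncated subtraction, comparison), a
  memory of real numbers (field operations, comparison, no rounding), and indirect addressing through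
  the natural-number memory. Each elementary operation is one step.
  The elements of \<open>U\<close> are numbered by a list \<open>xs\<close>; a subset of \<open>U\<close> is a block of
  \<open>length xs\<close> natural-number cells, read as a characteristic vector (nonzero means membership).
\<close>

datatype operand = Direct nat | Indirect nat

datatype cond = NLess operand operand | RLess operand operand

datatype com =
    SKIP
  | NConst operand nat
  | NAdd operand operand operand
  | NSub operand operand operand
  | RConst operand real
  | RAdd operand operand operand
  | RSub operand operand operand
  | RMul operand operand operand
  | RDiv operand operand operand
  | Bernoulli operand operand
  | Query operand operand
  | Seq com com
  | Branch cond com com
  | While cond com

record 'a state =
  nmem :: "nat \<Rightarrow> nat"
  rmem :: "nat \<Rightarrow> real"
  queries :: "'a set list"

primrec addr :: "'a state \<Rightarrow> operand \<Rightarrow> nat" where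
  "addr s (Direct i) = i"
| "addr s (Indirect i) = nmem s i"

abbreviation nval :: "'a state \<Rightarrow> operand \<Rightarrow> nat" where
  "nval s a \<equiv> nmem s (addr s a)"

abbreviation rval :: "'a state \<Rightarrow> operand \<Rightarrow> real" where
  "rval s a \<equiv> rmem s (addr s a)"

definition nset :: "operand \<Rightarrow> nat \<Rightarrow> 'a state \<Rightarrow> 'a state" where
  "nset a v s = s\<lparr>nmem := (nmem s)(addr s a := v)\<rparr>"

definition rset :: "operand \<Rightarrow> real \<Rightarrow> 'a state \<Rightarrow> 'a state" where
  "rset a v s = s\<lparr>rmem := (rmem s)(addr s a := v)\<rparr>"

primrec holds :: "cond \<Rightarrow> 'a state \<Rightarrow> bool" where
  "holds (NLess a b) s \<longleftrightarrow> nval s a < nval s b"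
| "holds (RLess a b) s \<longleftrightarrow> rval s a < rval s b"

definition set_at :: "'a list \<Rightarrow> 'a state \<Rightarrow> nat \<Rightarrow> 'a set" where
  "set_at xs s k = {xs ! i | i. i < length xs \<and> nmem s (k + i) \<noteq> 0}"

text \<open>
  \<open>Bernoulli a b\<close> stores in the natural-number cell \<open>a\<close> a fresh bit that is 1 with the probability
  held in the real cell \<open>b\<close> (clamped to \<open>[0,1]\<close> by \<^const>\<open>bernoulli_pmf\<close>). \<open>Query a b\<close> asks the
  oracle for the set whose characteristic vector starts at the natural-number cell \<open>b\<close> and stores
  the answer in the real cell \<open>a\<close>.
\<close>

primrec step :: "'a list \<Rightarrow> 'a answers \<Rightarrow> com \<Rightarrow> 'a state \<Rightarrow> (com \<times> 'a state) pmf" where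
  "step xs orc SKIP s = return_pmf (SKIP, s)"
| "step xs orc (NConst a k) s = return_pmf (SKIP, nset a k s)"
| "step xs orc (NAdd a b c) s = return_pmf (SKIP, nset a (nval s b + nval s c) s)"
| "step xs orc (NSub a b c) s = return_pmf (SKIP, nset a (nval s b - nval s c) s)"
| "step xs orc (RConst a r) s = return_pmf (SKIP, rset a r s)"
| "step xs orc (RAdd a b c) s = return_pmf (SKIP, rset a (rval s b + rval s c) s)"
| "step xs orc (RSub a b c) s = return_pmf (SKIP, rset a (rval s b - rval s c) s)"
| "step xs orc (RMul a b c) s = return_pmf (SKIP, rset a (rval s b * rval s c) s)"
| "step xs orc (RDiv a b c) s = return_pmf (SKIP, rset a (rval s b / rval s c) s)"
| "step xs orc (Bernoulli a b) s =
     map_pmf (\<lambda>t. (SKIP, nset a (if t then 1 else 0) s)) (bernoulli_pmf (rval s b))"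
| "step xs orc (Query a b) s =
     (let S = set_at xs s (addr s b)
      in return_pmf (SKIP, (rset a (orc (queries s) S) s)\<lparr>queries := S # queries s\<rparr>))"
| "step xs orc (Seq c d) s =
     (if c = SKIP then return_pmf (d, s)
      else map_pmf (\<lambda>(c', s'). (Seq c' d, s')) (step xs orc c s))"
| "step xs orc (Branch b c d) s = return_pmf (if holds b s then c else d, s)"
| "step xs orc (While b c) s =
     return_pmf (if holds b s then Seq c (While b c) else SKIP, s)"

text \<open>A configuration is halted when its command is \<^const>\<open>SKIP\<close>, which \<^const>\<open>step\<close> leaves as it is.\<close>

primrec run ::
  "'a list \<Rightarrow> 'a answers \<Rightarrow> nat \<Rightarrow> com \<times> 'a state \<Rightarrow> (com \<times> 'a state) pmf" where
  "run xs orc 0 cfg = return_pmf cfg"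
| "run xs orc (Suc t) cfg = bind_pmf (step xs orc (fst cfg) (snd cfg)) (run xs orc t)"

primrec com_length :: "com \<Rightarrow> nat" where
  "com_length SKIP = 1"
| "com_length (NConst a k) = 1"
| "com_length (NAdd a b c) = 1"
| "com_length (NSub a b c) = 1"
| "com_length (RConst a r) = 1"
| "com_length (RAdd a b c) = 1"
| "com_length (RSub a b c) = 1"
| "com_length (RMul a b c) = 1"
| "com_length (RDiv a b c) = 1"
| "com_length (Bernoulli a b) = 1"
| "com_length (Query a b) = 1"
| "com_length (Seq c d) = com_length c + com_length d + 1"
| "com_length (Branch b c d) = com_length c + com_length d + 1"
| "com_length (While b c) = com_length c + 1"

primrec query_free :: "com \<Rightarrow> bool" where
  "query_free SKIP \<longleftrightarrow> True"
| "query_free (NConst a k) \<longleftrightarrow> True"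
| "query_free (NAdd a b c) \<longleftrightarrow> True"
| "query_free (NSub a b c) \<longleftrightarrow> True"
| "query_free (RConst a r) \<longleftrightarrow> True"
| "query_free (RAdd a b c) \<longleftrightarrow> True"
| "query_free (RSub a b c) \<longleftrightarrow> True"
| "query_free (RMul a b c) \<longleftrightarrow> True"
| "query_free (RDiv a b c) \<longleftrightarrow> True"
| "query_free (Bernoulli a b) \<longleftrightarrow> True"
| "query_free (Query a b) \<longleftrightarrow> False"
| "query_free (Seq c d) \<longleftrightarrow> query_free c \<and> query_free d"
| "query_free (Branch b c d) \<longleftrightarrow> query_free c \<and> query_free d"
| "query_free (While b c) \<longleftrightarrow> query_free c"

section \<open>Learning algorithms\<close>

text \<open>
  The input is the product distribution: the real cell \<open>i\<close> holds the inclusion probability of the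
  element number \<open>i\<close>. All other cells are 0.
\<close>

definition initial_state :: "'a list \<Rightarrow> ('a \<Rightarrow> real) \<Rightarrow> 'a state" where
  "initial_state xs p =
     \<lparr>nmem = (\<lambda>_. 0), rmem = (\<lambda>i. if i < length xs then p (xs ! i) else 0), queries = []\<rparr>"

text \<open>
  An algorithm is a learning command together with an evaluation command. The memory contents \<open>s\<close>
  left by the learning command are the data structure that represents the output function \<open>h\<close>: to
  evaluate \<open>h\<close> at \<open>S\<close>, the characteristic vector of \<open>S\<close> is written into the first natural-number
  cells and the evaluation command, which has no oracle access, leaves \<open>h S\<close> in real cell 0,
  with a deterministic outcome.
\<close>

datatype algorithm = Algorithm (learner: com) (evaluator: com)

definition load_set :: "'a list \<Rightarrow> 'a set \<Rightarrow> 'a state \<Rightarrow> 'a state" where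
  "load_set xs S s =
     s\<lparr>nmem := (\<lambda>i. if i < length xs then (if xs ! i \<in> S then 1 else 0) else nmem s i)\<rparr>"

definition represents ::
  "'a list \<Rightarrow> 'a answers \<Rightarrow> nat \<Rightarrow> com \<Rightarrow> 'a state \<Rightarrow> ('a set \<Rightarrow> real) \<Rightarrow> bool" where
  "represents xs orc t e s h \<longleftrightarrow> query_free e \<and>
     (\<forall>S \<subseteq> set xs. \<exists>s'. run xs orc t (e, load_set xs S s) = return_pmf (SKIP, s') \<and> rmem s' 0 = h S)"

definition learning_result ::
  "'a list \<Rightarrow> 'a answers \<Rightarrow> ('a \<Rightarrow> real) \<Rightarrow> nat \<Rightarrow> algorithm \<Rightarrow> (com \<times> 'a state) pmf" where
  "learning_result xs orc p t A = run xs orc t (learner A, initial_state xs p)"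

text \<open>
  Within time \<open>t\<close>, whatever the random bits, the learning command halts with a representation of
  some function that is evaluated within time \<open>t\<close>.
\<close>

definition outputs_function_within ::
  "'a list \<Rightarrow> 'a answers \<Rightarrow> ('a \<Rightarrow> real) \<Rightarrow> nat \<Rightarrow> algorithm \<Rightarrow> bool" where
  "outputs_function_within xs orc p t A \<longleftrightarrow>
     (\<forall>(c, s) \<in> set_pmf (learning_result xs orc p t A).
        c = SKIP \<and> (\<exists>h. represents xs orc t (evaluator A) s h))"

definition success_probability ::
  "'a list \<Rightarrow> 'a answers \<Rightarrow> ('a \<Rightarrow> real) \<Rightarrow> nat \<Rightarrow> algorithm \<Rightarrow> (('a set \<Rightarrow> real) \<Rightarrow> bool) \<Rightarrow> real" where
  "success_probability xs orc p t A good =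
     measure_pmf.prob (learning_result xs orc p t A)
       {(c, s). c = SKIP \<and> (\<exists>h. represents xs orc t (evaluator A) s h \<and> good h)}"

text \<open>
  An algorithm may depend on \<open>U\<close>, \<open>\<alpha>\<close> and \<open>\<beta>\<close>; counting the length of its two commands as well
  excludes programs with large built-in tables.
\<close>

definition algorithm_length :: "algorithm \<Rightarrow> nat" where
  "algorithm_length A = com_length (learner A) + com_length (evaluator A)"

end

(*
  Scan the elements once and decide whether the answer for the current lower set plus x exceeds the
  answer for the lower set by more than 9/4 of the tolerance. If so, branch on x: an argument
  containing x adds it to the lower set and raises the value by at least a quarter of the tolerance,
  which happens O(log(1/beta)/alpha^2) times because f <= 1; an argument missing x removes it from
  the upper set. A second scan treats the upper set minus x symmetrically. By submodularity, all
  marginals of the undecided elements at a leaf are at most gamma = 17/4 of the tolerance in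
  absolute value, and the argument is still a product distribution on them.

  Such a function concentrates: for its Doob martingale the conditional variances add up to at most
  2 gamma surely, since the expected marginals telescope after the revealed coordinates are dropped.
  Hence f is within 9/10 alpha of the mean of its leaf with the required probability. The leaf means
  are averages of queries on common random sets, drawn after the tree is complete so that the
  (adaptive) oracle cannot correlate the tree with them; Chebyshev and Markov bound the
  probability mass of the leaves with a bad average.

  Both programs are loop-free: branches of the tree are lists of bits with boundedly many True
  entries, and the code for all of them is written out, so the program length bounds the time.
*)

theory Submission
  imports Defs
begin

section \<open>Expectations under a product distribution, one coordinate at a time\<close>

section \<open>Product distributions\<close>

text \<open>Bounding each martingale increment by \<gamma> alone would give a variance that grows
  with the number of elements. Submodularity removes this growth: an expected marginal that is
  nonnegative is at least as large on smaller sets, so such increments stack up to a rise of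
  \<open>f\<close>; negative ones stack up likewise on larger sets. Each total is at most 1. One
  scan per direction is enough because along a branch lower sets only grow and upper sets only
  shrink, so a test that was light keeps bounding its marginal. The prescribed tolerance leaves
  little slack. A difference of two answers is off by at most 2 tolerances, so the threshold of 2 +
  1/4 certifies rises of 1/4 and leaves marginals of 4 + 1/4. With deviation 9/10 \<alpha> the tail
  exponent is then about 2.57 times \<open>log_inv \<beta>\<close>; the excess over 1 pays for the
  two sides of the tail and for the share of \<beta> reserved for bad averages. No union bound over
  the leaves is taken: only the mass of arguments with a bad average has to be small, so the sample
  size is independent of the number of leaves.\<close>

abbreviation mean :: "'a set \<Rightarrow> ('a \<Rightarrow> real) \<Rightarrow> ('a set \<Rightarrow> real) \<Rightarrow> real" where
  "mean U p \<phi> \<equiv> measure_pmf.expectation (product_distribution U p) \<phi>"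

lemma set_product_distribution: "set_pmf (product_distribution U p) \<subseteq> Pow U"
  by (auto simp: product_distribution_def)

lemma finite_product_distribution: "finite U \<Longrightarrow> finite (set_pmf (product_distribution U p))"
  using set_product_distribution finite_subset by (metis finite_Pow_iff)

lemma integrable_product_distribution [simp]:
  "finite U \<Longrightarrow> integrable (measure_pmf (product_distribution U p)) (\<phi> :: 'a set \<Rightarrow> real)"
  by (simp add: finite_product_distribution integrable_measure_pmf_finite)

lemma mean_mono:
  assumes "finite U" "\<And>R. R \<subseteq> U \<Longrightarrow> \<phi> R \<le> \<psi> R"
  shows "mean U p \<phi> \<le> mean U p \<psi>"
  using assms set_product_distribution[of U p]
  by (intro integral_mono_AE) (auto simp: AE_measure_pmf_iff)

lemma mean_cong:
  assumes "\<And>R. R \<subseteq> U \<Longrightarrow> \<phi> R = \<psi> R"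
  shows "mean U p \<phi> = mean U p \<psi>"
  using assms set_product_distribution[of U p]
  by (intro integral_cong_AE) (auto simp: AE_measure_pmf_iff)

lemma mean_le_const:
  assumes "finite U" "\<And>R. R \<subseteq> U \<Longrightarrow> \<phi> R \<le> c"
  shows "mean U p \<phi> \<le> c"
  using mean_mono[OF assms(1), of \<phi> "\<lambda>_. c"] assms(2) by simp

lemma mean_ge_const:
  assumes "finite U" "\<And>R. R \<subseteq> U \<Longrightarrow> c \<le> \<phi> R"
  shows "c \<le> mean U p \<phi>"
  using mean_mono[OF assms(1), of "\<lambda>_. c" \<phi>] assms(2) by simp

lemma product_distribution_empty: "product_distribution {} p = return_pmf {}"
  by (simp add: product_distribution_def)

lemma product_distribution_insert:
  assumes "finite U" "x \<notin> U"
  shows "product_distribution (insert x U) p =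
    bind_pmf (bernoulli_pmf (p x)) (\<lambda>b. map_pmf (\<lambda>R. if b then insert x R else R) (product_distribution U p))"
proof -
  have *: "{y \<in> insert x U. (h(x := b)) y} = (if b then insert x {y \<in> U. h y} else {y \<in> U. h y})"
    for h b using assms by auto
  show ?thesis
    unfolding product_distribution_def Pi_pmf_insert'[OF assms]
    unfolding map_pmf_def bind_assoc_pmf bind_return_pmf * ..
qed

lemma mean_insert:
  assumes "finite U" "x \<notin> U" "p x \<in> {0..1}"
  shows "mean (insert x U) p \<phi> = p x * mean U p (\<lambda>R. \<phi> (insert x R)) + (1 - p x) * mean U p \<phi>"
  unfolding product_distribution_insert[OF assms(1,2)] using assms(3)
  by (subst pmf_expectation_bind[where A = UNIV])
     (auto simp: UNIV_bool finite_product_distribution assms)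

text \<open>Keeps \<open>x\<close> inside \<open>U\<close>: the decision tree overwrites coordinates
  of a draw on all of \<open>U\<close> instead of passing to a distribution on fewer
  elements.\<close>

lemma mean_resample:
  assumes "finite U" "x \<in> U" "p x \<in> {0..1}"
  shows "mean U p \<phi> = p x * mean U p (\<lambda>R. \<phi> (insert x R)) + (1 - p x) * mean U p (\<lambda>R. \<phi> (R - {x}))"
proof -
  obtain V where V: "U = insert x V" "x \<notin> V" "finite V"
    using assms by (metis finite_Diff insert_Diff mk_disjoint_insert finite_insert)
  have "mean V p (\<lambda>R. \<phi> (insert x R - {x})) = mean V p \<phi>" "mean V p (\<lambda>R. \<phi> (R - {x})) = mean V p \<phi>"
    by (rule mean_cong, use V in \<open>auto intro!: arg_cong[of _ _ \<phi>]\<close>)+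
  then show ?thesis
    using V assms by (simp add: mean_insert) (simp add: algebra_simps)
qed

section \<open>Exponential moments and two-sided tails, independent of the number of
  elements\<close>

section \<open>Concentration of submodular functions with small marginals\<close>

lemma submodular_onD:
  "submodular_on U f \<Longrightarrow> S \<subseteq> U \<Longrightarrow> T \<subseteq> U \<Longrightarrow> f (S \<union> T) + f (S \<inter> T) \<le> f S + f T"
  by (simp add: submodular_on_def)

lemma submodular_on_marginal:
  assumes "submodular_on U f" "A \<subseteq> B" "B \<subseteq> U" "x \<in> U" "x \<notin> B"
  shows "f (insert x B) - f B \<le> f (insert x A) - f A"
proof -
  have "f (insert x A \<union> B) + f (insert x A \<inter> B) \<le> f (insert x A) + f B"
    using assms by (intro submodular_onD[OF assms(1)]) auto
  moreover have "insert x A \<union> B = insert x B" "insert x A \<inter> B = A" using assms by auto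
  ultimately show ?thesis by simp
qed

text \<open>The cubic Taylor remainder is at most u^2/6, since \<open>exp t \<le> 2\<close> and
  \<open>\<bar>u\<bar> \<le> 1 / 2\<close>; and 1/2 + 1/6 = 2/3. With 1 in place of 2/3 the tail
  exponent used in the theorem would fall to about 1.7 times \<open>log_inv \<beta>\<close>, too
  little at \<beta> = 1/2.\<close>

lemma exp_le_quadratic:
  fixes u :: real
  assumes "\<bar>u\<bar> \<le> 1 / 2"
  shows "exp u \<le> 1 + u + 2 / 3 * u\<^sup>2"
proof -
  obtain t where t: "\<bar>t\<bar> \<le> \<bar>u\<bar>" "exp u = (\<Sum>m<3. u ^ m / fact m) + exp t / fact 3 * u ^ 3"
    using Maclaurin_exp_le[of u 3] by blast
  have "exp t \<le> exp (1 / 2)" using t assms by simp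
  also have "\<dots> \<le> 1 + 1 / 2 + (1 / 2)\<^sup>2" by (rule exp_bound) auto
  finally have "exp t \<le> 2" by (simp add: power2_eq_square)
  have "exp t * u \<le> exp t * (1 / 2)" using assms by (intro mult_left_mono) auto
  then have "exp t / 6 * u \<le> 1 / 6" using \<open>exp t \<le> 2\<close> by linarith
  then have "exp t / 6 * u * u\<^sup>2 \<le> 1 / 6 * u\<^sup>2" by (intro mult_right_mono) auto
  then have "exp t / fact 3 * u ^ 3 \<le> 1 / 6 * u\<^sup>2"
    by (simp add: fact_numeral power2_eq_square power3_eq_cube algebra_simps)
  moreover have "(\<Sum>m<3. u ^ m / fact m) = 1 + u + u\<^sup>2 / 2" by (simp add: eval_nat_numeral)
  moreover have "fact 3 = (6 :: real)" by (simp add: fact_numeral)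
  ultimately show ?thesis unfolding t(2) by simp
qed

text \<open>The two values are the increments of the Doob martingale when a coordinate of bias
  \<open>p\<close> and expected marginal \<open>g\<close> is revealed. The linear terms cancel and
  the variance \<open>p * (1 - p) * g\<^sup>2\<close> remains.\<close>

lemma two_point_mgf:
  fixes p g l :: real
  assumes p: "p \<in> {0..1}" and g: "\<bar>l * g\<bar> \<le> 1 / 2"
  shows "p * exp (l * ((1 - p) * g)) + (1 - p) * exp (l * (- p * g)) \<le> exp (2 / 3 * l\<^sup>2 * (p * (1 - p) * g\<^sup>2))"
proof -
  have b: "\<bar>c * (l * g)\<bar> \<le> 1 / 2" if "\<bar>c\<bar> \<le> 1" for c
    using mult_mono[OF that g] by (simp add: abs_mult)
  have 1: "exp (l * ((1 - p) * g)) \<le> 1 + l * ((1 - p) * g) + 2 / 3 * (l * ((1 - p) * g))\<^sup>2"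
    using exp_le_quadratic[of "l * ((1 - p) * g)"] b[of "1 - p"] p by (simp add: mult_ac)
  have 2: "exp (l * (- p * g)) \<le> 1 + l * (- p * g) + 2 / 3 * (l * (- p * g))\<^sup>2"
    using exp_le_quadratic[of "l * (- p * g)"] b[of p] p by (simp add: mult_ac)
  have "p * exp (l * ((1 - p) * g)) + (1 - p) * exp (l * (- p * g))
      \<le> p * (1 + l * ((1 - p) * g) + 2 / 3 * (l * ((1 - p) * g))\<^sup>2)
        + (1 - p) * (1 + l * (- p * g) + 2 / 3 * (l * (- p * g))\<^sup>2)"
    using p by (intro add_mono mult_left_mono 1 2) auto
  also have "\<dots> = 1 + 2 / 3 * l\<^sup>2 * (p * (1 - p) * g\<^sup>2)"
    by (simp add: power2_eq_square field_simps)
  also have "\<dots> \<le> exp (2 / 3 * l\<^sup>2 * (p * (1 - p) * g\<^sup>2))"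
    by (rule exp_ge_add_one_self)
  finally show ?thesis .
qed

text \<open>
  The budgets \<open>a\<close> and \<open>b\<close> pay for the conditional variances of the Doob martingale: revealing
  \<open>x\<close> costs at most \<open>\<gamma>\<close> times the drop of \<open>a\<close> if the expected marginal of \<open>x\<close> is nonnegative
  and \<open>\<gamma>\<close> times the drop of \<open>b\<close> otherwise.
\<close>

lemma submodular_mgf:
  assumes "finite U" "submodular_on U f" "\<And>x. x \<in> U \<Longrightarrow> p x \<in> {0..1}"
    and "\<And>x R. x \<in> U \<Longrightarrow> R \<subseteq> U - {x} \<Longrightarrow> \<bar>f (insert x R) - f R\<bar> \<le> \<gamma>"
    and "\<And>A. A \<subseteq> U \<Longrightarrow> mean U p (\<lambda>R. f (R \<inter> A)) - f {} \<le> a"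
    and "\<And>A. A \<subseteq> U \<Longrightarrow> mean U p (\<lambda>R. f (R \<union> A)) - f U \<le> b"
    and "0 \<le> \<gamma>" "\<bar>l\<bar> * \<gamma> \<le> 1 / 2"
  shows "mean U p (\<lambda>R. exp (l * (f R - mean U p f))) \<le> exp (2 / 3 * l\<^sup>2 * \<gamma> * (a + b))"
  using assms(1-6)
proof (induction U arbitrary: f a b rule: finite_induct)
  case empty
  have "0 \<le> a" "0 \<le> b" using empty.prems(4)[of "{}"] empty.prems(5)[of "{}"]
    by (simp_all add: product_distribution_empty)
  then show ?case using \<open>0 \<le> \<gamma>\<close> by (simp add: product_distribution_empty)
next
  case (insert x U)
  let ?p = "p x" and ?f1 = "\<lambda>R. f (insert x R)"
  define g where "g = mean U p ?f1 - mean U p f"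
  have p: "?p \<in> {0..1}" and pU: "\<And>y. y \<in> U \<Longrightarrow> p y \<in> {0..1}" using insert.prems(2) by auto
  note ins = mean_insert[where p = p and U = U and x = x, OF insert.hyps p]
  have marg: "f (insert x B) - f B \<le> f (insert x A) - f A" if "A \<subseteq> B" "B \<subseteq> U" for A B
    using submodular_on_marginal[OF insert.prems(1), of A B x] that insert.hyps by blast
  have g_eq: "g = mean U p (\<lambda>R. ?f1 R - f R)"
    unfolding g_def using insert.hyps by simp
  have m: "\<bar>?f1 R - f R\<bar> \<le> \<gamma>" if "R \<subseteq> U" for R
    using insert.prems(3)[of x R] insert.hyps that by blast
  have "?f1 R - f R \<le> \<gamma>" "- \<gamma> \<le> ?f1 R - f R" if "R \<subseteq> U" for R
    using m[OF that] by linarith+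
  then have "g \<le> \<gamma>" "- \<gamma> \<le> g"
    unfolding g_eq by (intro mean_le_const mean_ge_const insert.hyps; simp)+
  then have g: "\<bar>g\<bar> \<le> \<gamma>" by simp
  \<comment> \<open>Diminishing returns: intersecting the argument with \<open>A\<close> raises the
    marginal of \<open>x\<close>, joining it with \<open>A\<close> lowers it. This relates
    \<open>g\<close> to the sets on which the budgets are measured.\<close>
  have inter: "g \<le> mean U p (\<lambda>R. ?f1 (R \<inter> A)) - mean U p (\<lambda>R. f (R \<inter> A))" for A
  proof -
    have "g \<le> mean U p (\<lambda>R. ?f1 (R \<inter> A) - f (R \<inter> A))"
      unfolding g_eq by (rule mean_mono) (use insert.hyps marg in auto)
    then show ?thesis using insert.hyps by simp
  qed
  have union: "mean U p (\<lambda>R. ?f1 (R \<union> A)) - mean U p (\<lambda>R. f (R \<union> A)) \<le> g" if "A \<subseteq> U" for A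
  proof -
    have "mean U p (\<lambda>R. ?f1 (R \<union> A) - f (R \<union> A)) \<le> g"
      unfolding g_eq by (rule mean_mono) (use insert.hyps marg that in auto)
    then show ?thesis using insert.hyps by simp
  qed
  define a' where "a' = a - ?p * max 0 g"
  define b' where "b' = b - (1 - ?p) * max 0 (- g)"
  \<comment> \<open>For \<open>g \<ge> 0\<close> the old budget is applied to
    \<open>insert x A\<close>: the presence of \<open>x\<close> contributes at least
    \<open>p x * g\<close>, which the new budget no longer contains. For \<open>g < 0\<close> it is
    applied to \<open>A\<close>, and \<open>x\<close> is dropped from the argument free of charge.
    As the choice depends on the sign of \<open>g\<close>, the budgets quantify over all
    \<open>A\<close>.\<close>
  have a0: "mean U p (\<lambda>R. f (R \<inter> A)) - f {} \<le> a'" if A: "A \<subseteq> U" for A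
  proof (cases "g \<ge> 0")
    case True
    have eq: "mean U p (\<lambda>R. f (insert x R \<inter> insert x A)) = mean U p (\<lambda>R. ?f1 (R \<inter> A))"
      "mean U p (\<lambda>R. f (R \<inter> insert x A)) = mean U p (\<lambda>R. f (R \<inter> A))"
      by (rule mean_cong, use insert.hyps in \<open>auto intro!: arg_cong[of _ _ f]\<close>)+
    have "?p * mean U p (\<lambda>R. ?f1 (R \<inter> A)) + (1 - ?p) * mean U p (\<lambda>R. f (R \<inter> A)) - f {} \<le> a"
      using insert.prems(4)[of "insert x A"] A unfolding ins eq by auto
    moreover have "?p * (g + mean U p (\<lambda>R. f (R \<inter> A))) \<le> ?p * mean U p (\<lambda>R. ?f1 (R \<inter> A))"
      using inter[of A] p by (intro mult_left_mono) auto
    ultimately show ?thesis using True by (simp add: a'_def algebra_simps)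
  next
    case False
    have eq: "mean U p (\<lambda>R. f (insert x R \<inter> A)) = mean U p (\<lambda>R. f (R \<inter> A))"
      by (rule mean_cong, use insert.hyps A in \<open>auto intro!: arg_cong[of _ _ f]\<close>)
    have "mean U p (\<lambda>R. f (R \<inter> A)) - f {} \<le> a"
      using insert.prems(4)[of A] A unfolding ins eq by (auto simp: algebra_simps)
    then show ?thesis using False by (simp add: a'_def)
  qed
  \<comment> \<open>With \<open>x\<close> present all marginals are smaller, so rises above the
    least set are too. For \<open>b\<close> the roles are exchanged: there the case without
    \<open>x\<close> inherits the bound.\<close>
  have a1: "mean U p (\<lambda>R. ?f1 (R \<inter> A)) - ?f1 {} \<le> a'" if A: "A \<subseteq> U" for A
  proof -
    have "?f1 (R \<inter> A) \<le> f (R \<inter> A) + (?f1 {} - f {})" for R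
      using marg[of "{}" "R \<inter> A"] A by (simp add: le_infI2)
    then have "mean U p (\<lambda>R. ?f1 (R \<inter> A)) \<le> mean U p (\<lambda>R. f (R \<inter> A) + (?f1 {} - f {}))"
      using insert.hyps by (intro mean_mono)
    then show ?thesis using a0[OF A] insert.hyps by simp
  qed
  have b1: "mean U p (\<lambda>R. ?f1 (R \<union> A)) - ?f1 U \<le> b'" if A: "A \<subseteq> U" for A
  proof (cases "g \<ge> 0")
    case True
    have "mean U p (\<lambda>R. ?f1 (R \<union> A)) - ?f1 U \<le> b"
      using insert.prems(5)[of "insert x A"] A unfolding ins by (auto simp: algebra_simps)
    then show ?thesis using True by (simp add: b'_def)
  next
    case False
    have "?p * mean U p (\<lambda>R. ?f1 (R \<union> A)) + (1 - ?p) * mean U p (\<lambda>R. f (R \<union> A)) - ?f1 U \<le> b"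
      using insert.prems(5)[of A] A unfolding ins by auto
    moreover have "(1 - ?p) * (mean U p (\<lambda>R. ?f1 (R \<union> A)) - g) \<le> (1 - ?p) * mean U p (\<lambda>R. f (R \<union> A))"
      using union[OF A] p by (intro mult_left_mono) auto
    ultimately show ?thesis using False by (simp add: b'_def algebra_simps)
  qed
  have b0: "mean U p (\<lambda>R. f (R \<union> A)) - f U \<le> b'" if A: "A \<subseteq> U" for A
  proof -
    have "f (R \<union> A) \<le> ?f1 (R \<union> A) - (?f1 U - f U)" if "R \<subseteq> U" for R
      using marg[of "R \<union> A" U] A that by simp
    then have "mean U p (\<lambda>R. f (R \<union> A)) \<le> mean U p (\<lambda>R. ?f1 (R \<union> A) - (?f1 U - f U))"
      using insert.hyps by (intro mean_mono)
    then show ?thesis using b1[OF A] insert.hyps by simp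
  qed
  define c where "c = 2 / 3 * l\<^sup>2 * \<gamma>"
  have IH0: "mean U p (\<lambda>R. exp (l * (f R - mean U p f))) \<le> exp (c * (a' + b'))" unfolding c_def
  proof (rule insert.IH[OF _ pU _ a0 b0])
    show "submodular_on U f" using insert.prems(1) by (auto simp: submodular_on_def)
    show "\<bar>f (insert y R) - f R\<bar> \<le> \<gamma>" if "y \<in> U" "R \<subseteq> U - {y}" for y R
      using insert.prems(3)[of y R] that by blast
  qed
  have IH1: "mean U p (\<lambda>R. exp (l * (?f1 R - mean U p ?f1))) \<le> exp (c * (a' + b'))" unfolding c_def
  proof (rule insert.IH[OF _ pU _ a1 b1])
    show "submodular_on U ?f1" unfolding submodular_on_def
    proof (intro allI impI)
      fix S T assume ST: "S \<subseteq> U" "T \<subseteq> U"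
      have "insert x S \<inter> insert x T = insert x (S \<inter> T)" "insert x S \<union> insert x T = insert x (S \<union> T)"
        by auto
      moreover have "f (insert x S \<union> insert x T) + f (insert x S \<inter> insert x T) \<le> ?f1 S + ?f1 T"
        using ST by (intro submodular_onD[OF insert.prems(1)]) auto
      ultimately show "?f1 (S \<union> T) + ?f1 (S \<inter> T) \<le> ?f1 S + ?f1 T" by simp
    qed
    show "\<bar>?f1 (insert y R) - ?f1 R\<bar> \<le> \<gamma>" if "y \<in> U" "R \<subseteq> U - {y}" for y R
    proof -
      have "insert x R \<subseteq> insert x U - {y}" using that insert.hyps by auto
      then show ?thesis
        using insert.prems(3)[of y "insert x R"] that by (simp add: insert_commute)
    qed
  qed
  have c: "0 \<le> c" using \<open>0 \<le> \<gamma>\<close> by (simp add: c_def)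
  define M where "M = mean (insert x U) p f"
  have M: "mean U p ?f1 - M = (1 - ?p) * g" "mean U p f - M = - ?p * g"
    unfolding M_def ins g_def by (simp_all add: algebra_simps)
  have e1: "mean U p (\<lambda>R. exp (l * (?f1 R - M)))
      = exp (l * ((1 - ?p) * g)) * mean U p (\<lambda>R. exp (l * (?f1 R - mean U p ?f1)))"
    unfolding M(1)[symmetric] by (subst integral_mult_right_zero[symmetric])
      (simp add: exp_add[symmetric] algebra_simps)
  have e0: "mean U p (\<lambda>R. exp (l * (f R - M)))
      = exp (l * (- ?p * g)) * mean U p (\<lambda>R. exp (l * (f R - mean U p f)))"
    unfolding M(2)[symmetric] by (subst integral_mult_right_zero[symmetric])
      (simp add: exp_add[symmetric] algebra_simps)
  have lg: "\<bar>l * g\<bar> \<le> 1 / 2"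
    using mult_left_mono[OF g, of "\<bar>l\<bar>"] assms(8) by (simp add: abs_mult)
  have "mean (insert x U) p (\<lambda>R. exp (l * (f R - M))) =
     ?p * (exp (l * ((1 - ?p) * g)) * mean U p (\<lambda>R. exp (l * (?f1 R - mean U p ?f1))))
     + (1 - ?p) * (exp (l * (- ?p * g)) * mean U p (\<lambda>R. exp (l * (f R - mean U p f))))"
    unfolding ins e0 e1 ..
  also have "\<dots> \<le> ?p * (exp (l * ((1 - ?p) * g)) * exp (c * (a' + b')))
     + (1 - ?p) * (exp (l * (- ?p * g)) * exp (c * (a' + b')))"
    using p by (intro add_mono mult_left_mono IH0 IH1) auto
  also have "\<dots> = (?p * exp (l * ((1 - ?p) * g)) + (1 - ?p) * exp (l * (- ?p * g))) * exp (c * (a' + b'))"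
    by (simp add: algebra_simps)
  also have "\<dots> \<le> exp (2 / 3 * l\<^sup>2 * (?p * (1 - ?p) * g\<^sup>2)) * exp (c * (a' + b'))"
    by (intro mult_right_mono two_point_mgf p lg) auto
  \<comment> \<open>Only one factor of \<open>g\<^sup>2\<close> is estimated by \<gamma>. The other
    stays linear, because the budgets control sums of expected marginals and not of their
    squares.\<close>
  also have "\<dots> \<le> exp (c * (?p * (1 - ?p) * \<bar>g\<bar>)) * exp (c * (a' + b'))"
  proof -
    have "g\<^sup>2 \<le> \<gamma> * \<bar>g\<bar>" using mult_right_mono[OF g, of "\<bar>g\<bar>"] by (simp add: power2_eq_square)
    then have "2 / 3 * l\<^sup>2 * (?p * (1 - ?p)) * g\<^sup>2 \<le> 2 / 3 * l\<^sup>2 * (?p * (1 - ?p)) * (\<gamma> * \<bar>g\<bar>)"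
      using p by (intro mult_left_mono) auto
    then show ?thesis by (simp add: c_def mult_ac)
  qed
  also have "\<dots> = exp (c * (a' + b' + ?p * (1 - ?p) * \<bar>g\<bar>))"
    by (simp add: exp_add[symmetric] algebra_simps)
  also have "\<dots> \<le> exp (c * (a + b))"
  proof -
    have "?p * (1 - ?p) * \<bar>g\<bar> \<le> ?p * \<bar>g\<bar>" "?p * (1 - ?p) * \<bar>g\<bar> \<le> (1 - ?p) * \<bar>g\<bar>"
      using p by (auto intro!: mult_right_mono mult_left_le mult_left_le_one_le)
    then have "a' + b' + ?p * (1 - ?p) * \<bar>g\<bar> \<le> a + b"
      by (cases "g \<ge> 0") (auto simp: a'_def b'_def max_def)
    then show ?thesis using c by (simp add: mult_left_mono)
  qed
  finally show ?case unfolding M_def c_def .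
qed

text \<open>Chernoff bound for both signs; values in [0,1] make both budgets equal to 1.\<close>

lemma submodular_tail:
  assumes U: "finite U" and sub: "submodular_on U f" and p: "\<And>x. x \<in> U \<Longrightarrow> p x \<in> {0..1}"
    and f: "\<And>S. S \<subseteq> U \<Longrightarrow> f S \<in> {0..1}"
    and marg: "\<And>x R. x \<in> U \<Longrightarrow> R \<subseteq> U - {x} \<Longrightarrow> \<bar>f (insert x R) - f R\<bar> \<le> \<gamma>"
    and \<gamma>: "0 < \<gamma>" and t: "0 < t" "t \<le> 1"
  shows "measure_pmf.prob (product_distribution U p) {R. \<bar>f R - mean U p f\<bar> > t}
    \<le> 2 * exp (- (3 * t\<^sup>2) / (16 * \<gamma>))"
proof -
  let ?D = "product_distribution U p"
  \<comment> \<open>The minimiser of \<open>4 / 3 * l\<^sup>2 * \<gamma> - l * t\<close>. It is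
    admissible for the moment bound because \<open>l * \<gamma> = 3 * t / 8\<close> and
    \<open>t \<le> 1\<close>.\<close>
  define l where "l = 3 * t / (8 * \<gamma>)"
  have l: "0 < l" "l * \<gamma> \<le> 1 / 2" using \<gamma> t by (auto simp: l_def)
  have expo: "2 / 3 * l\<^sup>2 * \<gamma> * (1 + 1) - l * t = - (3 * t\<^sup>2) / (16 * \<gamma>)"
    using \<gamma> by (simp add: l_def field_simps power2_eq_square)
  have mgf: "mean U p (\<lambda>R. exp (k * (f R - mean U p f))) \<le> exp (2 / 3 * l\<^sup>2 * \<gamma> * (1 + 1))"
    if k: "\<bar>k\<bar> = l" for k
  proof -
    have "k\<^sup>2 = l\<^sup>2" using k by (metis power2_abs)
    moreover have "mean U p (\<lambda>R. exp (k * (f R - mean U p f))) \<le> exp (2 / 3 * k\<^sup>2 * \<gamma> * (1 + 1))"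
    proof (rule submodular_mgf[OF U sub p marg])
      fix A assume A: "A \<subseteq> U"
      have "mean U p (\<lambda>R. f (R \<inter> A)) \<le> 1" using f by (intro mean_le_const U) (auto simp: le_infI1)
      moreover have "0 \<le> f {}" using f[of "{}"] by simp
      ultimately show "mean U p (\<lambda>R. f (R \<inter> A)) - f {} \<le> 1" by linarith
      have "mean U p (\<lambda>R. f (R \<union> A)) \<le> 1" using f A by (intro mean_le_const U) auto
      moreover have "0 \<le> f U" using f[of U] by simp
      ultimately show "mean U p (\<lambda>R. f (R \<union> A)) - f U \<le> 1" by linarith
    qed (use l k \<gamma> in auto)
    ultimately show ?thesis by simp
  qed
  have tail: "measure_pmf.prob ?D {R. t < s * (f R - mean U p f)} \<le> exp (- (3 * t\<^sup>2) / (16 * \<gamma>))"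
    if s: "\<bar>s\<bar> = 1" for s
  proof -
    have "measure_pmf.prob ?D {R. t < s * (f R - mean U p f)}
        = mean U p (indicator {R. t < s * (f R - mean U p f)})" by simp
    also have "\<dots> \<le> mean U p (\<lambda>R. exp (- (l * t)) * exp ((l * s) * (f R - mean U p f)))"
    proof (rule mean_mono[OF U])
      fix R
      have "l * t \<le> l * (s * (f R - mean U p f))" if "t < s * (f R - mean U p f)"
        using that l by simp
      then show "indicator {R. t < s * (f R - mean U p f)} R
          \<le> exp (- (l * t)) * exp ((l * s) * (f R - mean U p f))"
        by (auto simp: indicator_def exp_add[symmetric] mult.assoc)
    qed
    also have "\<dots> = exp (- (l * t)) * mean U p (\<lambda>R. exp ((l * s) * (f R - mean U p f)))"
      by simp
    also have "\<dots> \<le> exp (- (l * t)) * exp (2 / 3 * l\<^sup>2 * \<gamma> * (1 + 1))"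
      using s l by (intro mult_left_mono mgf) (auto simp: abs_mult)
    also have "\<dots> = exp (- (3 * t\<^sup>2) / (16 * \<gamma>))"
      unfolding expo[symmetric] by (simp add: exp_add[symmetric])
    finally show ?thesis .
  qed
  have "{R. \<bar>f R - mean U p f\<bar> > t}
      = {R. t < 1 * (f R - mean U p f)} \<union> {R. t < - 1 * (f R - mean U p f)}" by auto
  then have "measure_pmf.prob ?D {R. \<bar>f R - mean U p f\<bar> > t}
      \<le> measure_pmf.prob ?D {R. t < 1 * (f R - mean U p f)} + measure_pmf.prob ?D {R. t < - 1 * (f R - mean U p f)}"
    by (simp add: measure_Un_le)
  also have "\<dots> \<le> 2 * exp (- (3 * t\<^sup>2) / (16 * \<gamma>))"
    using tail[of 1] tail[of "- 1"] by simp
  finally show ?thesis .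
qed

section \<open>Chebyshev for one average, and Markov for the mass of bad averages\<close>

section \<open>Independent samples\<close>

primrec iid_pmf :: "nat \<Rightarrow> 'b pmf \<Rightarrow> (nat \<Rightarrow> 'b) pmf" where
  "iid_pmf 0 D = return_pmf (\<lambda>_. undefined)"
| "iid_pmf (Suc m) D = bind_pmf (iid_pmf m D) (\<lambda>r. map_pmf (\<lambda>S. r(m := S)) D)"

lemma finite_iid_pmf: "finite (set_pmf D) \<Longrightarrow> finite (set_pmf (iid_pmf m D))"
  by (induction m) auto

lemma iid_pmf_in: "r \<in> set_pmf (iid_pmf m D) \<Longrightarrow> k < m \<Longrightarrow> r k \<in> set_pmf D"
  by (induction m arbitrary: r) (auto simp: less_Suc_eq)

lemma expectation_iid_Suc:
  fixes \<phi> :: "(nat \<Rightarrow> 'b) \<Rightarrow> real"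
  assumes "finite (set_pmf D)"
  shows "measure_pmf.expectation (iid_pmf (Suc m) D) \<phi>
    = measure_pmf.expectation (iid_pmf m D) (\<lambda>r. measure_pmf.expectation D (\<lambda>S. \<phi> (r(m := S))))"
  using assms
  by (simp add: pmf_expectation_bind[where A = "set_pmf (iid_pmf m D)"] finite_iid_pmf
      integral_measure_pmf[where A = "set_pmf (iid_pmf m D)"])

lemma expectation_sum_iid:
  fixes g :: "'b \<Rightarrow> real"
  assumes fin: "finite (set_pmf D)" and g: "measure_pmf.expectation D g = 0"
  shows "measure_pmf.expectation (iid_pmf m D) (\<lambda>r. \<Sum>k<m. g (r k)) = 0"
    and "measure_pmf.expectation (iid_pmf m D) (\<lambda>r. (\<Sum>k<m. g (r k))\<^sup>2) = real m * measure_pmf.expectation D (\<lambda>S. (g S)\<^sup>2)"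
proof -
  have int: "integrable (measure_pmf D) \<phi>" "integrable (measure_pmf (iid_pmf m D)) \<psi>"
    for \<phi> :: "_ \<Rightarrow> real" and \<psi> :: "_ \<Rightarrow> real" and m
    by (simp_all add: integrable_measure_pmf_finite finite_iid_pmf fin)
  have sum: "(\<Sum>k<Suc m. g ((r(m := S)) k)) = (\<Sum>k<m. g (r k)) + g S" for m r S by simp
  note step = expectation_iid_Suc[OF fin] sum
  have 1: "measure_pmf.expectation (iid_pmf m D) (\<lambda>r. \<Sum>k<m. g (r k)) = 0" for m
  proof (induction m)
    case (Suc m)
    then show ?case unfolding step by (simp add: int g del: Bochner_Integration.integral_sum)
  qed simp
  then show "measure_pmf.expectation (iid_pmf m D) (\<lambda>r. \<Sum>k<m. g (r k)) = 0" .
  show "measure_pmf.expectation (iid_pmf m D) (\<lambda>r. (\<Sum>k<m. g (r k))\<^sup>2) = real m * measure_pmf.expectation D (\<lambda>S. (g S)\<^sup>2)"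
  proof (induction m)
    case (Suc m)
    have "measure_pmf.expectation D (\<lambda>S. (c + g S)\<^sup>2) = c\<^sup>2 + measure_pmf.expectation D (\<lambda>S. (g S)\<^sup>2)" for c
      by (simp add: power2_sum int g)
    with Suc show ?case unfolding step by (simp add: int ring_distribs)
  qed simp
qed

text \<open>Chebyshev with variance at most 1. A polynomial dependence of the sample size on
  1/\<beta> is affordable: it is absorbed by a power with exponent of order log (1/\<beta>) of a
  base that is at least 2.\<close>

lemma prob_average_iid_far:
  fixes g :: "'b \<Rightarrow> real"
  assumes fin: "finite (set_pmf D)" and g: "\<And>S. S \<in> set_pmf D \<Longrightarrow> g S \<in> {0..1}" and \<epsilon>: "0 < \<epsilon>" and m: "0 < m"
  shows "measure_pmf.prob (iid_pmf m D) {r. \<bar>(\<Sum>k<m. g (r k)) / m - measure_pmf.expectation D g\<bar> > \<epsilon>}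
    \<le> 1 / (real m * \<epsilon>\<^sup>2)"
proof -
  let ?\<mu> = "measure_pmf.expectation D g"
  have int: "integrable (measure_pmf D) \<phi>" for \<phi> :: "_ \<Rightarrow> real"
    by (simp add: integrable_measure_pmf_finite fin)
  have \<mu>: "0 \<le> ?\<mu>" "?\<mu> \<le> 1"
    using g by (auto intro!: integral_nonneg_AE measure_pmf.integral_le_const int simp: AE_measure_pmf_iff)
  let ?h = "\<lambda>S. g S - ?\<mu>"
  have "measure_pmf.expectation D ?h = 0" by (simp add: int)
  note second_moment = expectation_sum_iid(2)[OF fin this]
  have "\<bar>?h S\<bar> \<le> 1" if "S \<in> set_pmf D" for S using g[OF that] \<mu> by (auto simp: abs_le_iff)
  then have "(?h S)\<^sup>2 \<le> 1" if "S \<in> set_pmf D" for S using that by (simp add: abs_square_le_1)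
  then have var: "measure_pmf.expectation D (\<lambda>S. (?h S)\<^sup>2) \<le> 1"
    by (auto intro!: measure_pmf.integral_le_const int simp: AE_measure_pmf_iff)
  have far: "(real m * \<epsilon>)\<^sup>2 \<le> (\<Sum>k<m. ?h (r k))\<^sup>2" if "\<bar>(\<Sum>k<m. g (r k)) / m - ?\<mu>\<bar> > \<epsilon>" for r
  proof -
    have "(\<Sum>k<m. ?h (r k)) = real m * ((\<Sum>k<m. g (r k)) / m - ?\<mu>)"
      using m by (simp add: sum_subtractf field_simps)
    then have "\<bar>\<Sum>k<m. ?h (r k)\<bar> = real m * \<bar>(\<Sum>k<m. g (r k)) / m - ?\<mu>\<bar>"
      by (simp add: abs_mult)
    then have "real m * \<epsilon> \<le> \<bar>\<Sum>k<m. ?h (r k)\<bar>" using that m by simp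
    then show ?thesis using \<epsilon> by (metis abs_le_square_iff abs_of_nonneg less_eq_real_def mult_nonneg_nonneg of_nat_0_le_iff)
  qed
  have "measure_pmf.prob (iid_pmf m D) {r. \<bar>(\<Sum>k<m. g (r k)) / m - ?\<mu>\<bar> > \<epsilon>}
      \<le> measure_pmf.prob (iid_pmf m D) {r \<in> space (iid_pmf m D). (real m * \<epsilon>)\<^sup>2 \<le> (\<Sum>k<m. ?h (r k))\<^sup>2}"
    using far by (intro measure_pmf.finite_measure_mono) auto
  also have "\<dots> \<le> measure_pmf.expectation (iid_pmf m D) (\<lambda>r. (\<Sum>k<m. ?h (r k))\<^sup>2) / (real m * \<epsilon>)\<^sup>2"
    using m \<epsilon> by (intro integral_Markov_inequality_measure[where A = "{}"])
      (auto simp: integrable_measure_pmf_finite finite_iid_pmf fin)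
  also have "\<dots> \<le> real m * 1 / (real m * \<epsilon>)\<^sup>2"
    unfolding second_moment using var m by (intro divide_right_mono mult_left_mono) auto
  also have "\<dots> = 1 / (real m * \<epsilon>\<^sup>2)" using m by (simp add: power2_eq_square)
  finally show ?thesis .
qed

text \<open>Exchange the two expectations, then apply Markov. This allows all leaves to share the
  same random sets, however dependent their averages become.\<close>

lemma prob_prob_large:
  assumes A: "finite (set_pmf A)" and D: "finite (set_pmf D)" and c: "0 < c"
    and bound: "\<And>T. T \<in> set_pmf D \<Longrightarrow> measure_pmf.prob A {r. Q r T} \<le> \<eta>"
  shows "measure_pmf.prob A {r. c < measure_pmf.prob D {T. Q r T}} \<le> \<eta> / c"
proof -
  have int: "integrable (measure_pmf A) \<phi>" "integrable (measure_pmf D) \<psi>"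
    for \<phi> :: "_ \<Rightarrow> real" and \<psi> :: "_ \<Rightarrow> real"
    by (simp_all add: integrable_measure_pmf_finite A D)
  have sums: "measure_pmf.expectation A \<phi> = (\<Sum>r\<in>set_pmf A. \<phi> r * pmf A r)"
    "measure_pmf.expectation D \<psi> = (\<Sum>T\<in>set_pmf D. \<psi> T * pmf D T)" for \<phi> \<psi>
    by (rule integral_measure_pmf_real; simp add: A D)+
  have ind: "measure_pmf.prob M {x. P x} = measure_pmf.expectation M (\<lambda>x. of_bool (P x))"
    for M :: "'x pmf" and P
  proof -
    have "(\<lambda>x. of_bool (P x)) = (indicator {x. P x} :: 'x \<Rightarrow> real)" by (auto simp: indicator_def)
    then show ?thesis by simp
  qed
  have "measure_pmf.prob A {r. c < measure_pmf.prob D {T. Q r T}}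
      \<le> measure_pmf.prob A {r \<in> space A. c \<le> measure_pmf.prob D {T. Q r T}}"
    by (intro measure_pmf.finite_measure_mono) auto
  also have "\<dots> \<le> measure_pmf.expectation A (\<lambda>r. measure_pmf.prob D {T. Q r T}) / c"
    using c by (intro integral_Markov_inequality_measure[where A = "{}"]) (auto simp: int)
  also have "measure_pmf.expectation A (\<lambda>r. measure_pmf.prob D {T. Q r T})
      = measure_pmf.expectation D (\<lambda>T. measure_pmf.prob A {r. Q r T})"
    unfolding ind sums
    by (simp add: sum_distrib_left sum_distrib_right mult_ac sum.swap[of _ "set_pmf D"])
  also have "\<dots> \<le> \<eta>"
    using bound by (auto intro!: measure_pmf.integral_le_const int simp: AE_measure_pmf_iff)
  finally show ?thesis using c by (simp add: divide_right_mono)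
qed

section \<open>Length of the branches, marginals at the leaves, concentration around leaf
  means\<close>

section \<open>The decision tree\<close>

text \<open>
  Step \<open>l < length xs\<close> of the tree tests the element number \<open>l\<close> at the current lower set and step
  \<open>length xs + l\<close> tests it at the current upper set. A node is the list of the steps made so far,
  latest first; \<open>True\<close> records a step that raises the value of the set that is being tested.
\<close>

definition tested_element :: "'a list \<Rightarrow> nat \<Rightarrow> 'a" where
  "tested_element xs l = xs ! (if l < length xs then l else l - length xs)"

definition put :: "bool \<Rightarrow> 'a \<Rightarrow> 'a set \<Rightarrow> 'a set" where
  "put b x R = (if b then insert x R else R - {x})"

text \<open>A \<open>True\<close> entry forces its element without consulting \<open>hv\<close>, so
  the set of \<open>True # \<pi>\<close> depends on \<open>hv\<close> only at proper suffixes of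
  \<pi>. Both queries at \<pi> can thus be made before \<open>hv \<pi>\<close> is known. A
  \<open>False\<close> entry forces the opposite value if the node is heavy and leaves the element
  open otherwise.\<close>

primrec force_path :: "'a list \<Rightarrow> (bool list \<Rightarrow> bool) \<Rightarrow> bool list \<Rightarrow> 'a set \<Rightarrow> 'a set" where
  "force_path xs hv [] R = R"
| "force_path xs hv (b # \<pi>) R =
     (if b \<or> hv \<pi> then put (b \<longleftrightarrow> length \<pi> < length xs) (tested_element xs (length \<pi>)) (force_path xs hv \<pi> R)
      else force_path xs hv \<pi> R)"

primrec branch :: "'a list \<Rightarrow> (bool list \<Rightarrow> bool) \<Rightarrow> 'a set \<Rightarrow> nat \<Rightarrow> bool list" where
  "branch xs hv T 0 = []"
| "branch xs hv T (Suc l) =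
     (hv (branch xs hv T l) \<and> (tested_element xs l \<in> T \<longleftrightarrow> l < length xs)) # branch xs hv T l"

definition extreme_set :: "'a list \<Rightarrow> nat \<Rightarrow> 'a set" where
  "extreme_set xs l = (if l < length xs then {} else set xs)"

lemma length_branch [simp]: "length (branch xs hv T l) = l"
  by (induction l) auto

lemma force_path_cong:
  assumes "\<And>\<sigma>. length \<sigma> < length \<pi> \<Longrightarrow> \<sigma> = drop (length \<pi> - length \<sigma>) \<pi> \<Longrightarrow> hv \<sigma> = hv' \<sigma>"
  shows "force_path xs hv \<pi> R = force_path xs hv' \<pi> R"
  using assms
proof (induction \<pi>)
  case (Cons b \<pi>)
  have "force_path xs hv \<pi> R = force_path xs hv' \<pi> R"
    by (rule Cons.IH, rule Cons.prems) (auto simp: Suc_diff_le)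
  moreover have "hv \<pi> = hv' \<pi>" by (rule Cons.prems) auto
  ultimately show ?case by simp
qed simp

text \<open>\<kappa> and \<gamma> are what a noisy test guarantees on its two sides. The guarantees
  cover only nodes with at most \<open>K\<close> entries \<open>True\<close>, those for which
  queries are made; \<open>2 \<le> real K * \<kappa>\<close> will keep every actual branch among
  them.\<close>

locale decision_tree =
  fixes xs :: "'a list" and f :: "'a set \<Rightarrow> real" and hv :: "bool list \<Rightarrow> bool"
    and \<kappa> \<gamma> :: real and K :: nat
  assumes submodular: "submodular_on (set xs) f"
    and range: "\<And>S. S \<subseteq> set xs \<Longrightarrow> f S \<in> {0..1}"
    and heavy: "\<And>\<pi>. length \<pi> < 2 * length xs \<Longrightarrow> count_list \<pi> True \<le> K \<Longrightarrow> hv \<pi> \<Longrightarrow>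
      \<kappa> < f (force_path xs hv (True # \<pi>) (extreme_set xs (length \<pi>)))
            - f (force_path xs hv \<pi> (extreme_set xs (length \<pi>)))"
    and light: "\<And>\<pi>. length \<pi> < 2 * length xs \<Longrightarrow> count_list \<pi> True \<le> K \<Longrightarrow> \<not> hv \<pi> \<Longrightarrow>
      f (force_path xs hv (True # \<pi>) (extreme_set xs (length \<pi>)))
            - f (force_path xs hv \<pi> (extreme_set xs (length \<pi>))) \<le> \<gamma>"
    and \<kappa>: "0 < \<kappa>" "2 \<le> real K * \<kappa>" and \<gamma>: "0 < \<gamma>"
begin

abbreviation n :: nat where "n \<equiv> length xs"
abbreviation U :: "'a set" where "U \<equiv> set xs"
abbreviation elt :: "nat \<Rightarrow> 'a" where "elt \<equiv> tested_element xs"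
abbreviation res :: "bool list \<Rightarrow> 'a set \<Rightarrow> 'a set" where "res \<equiv> force_path xs hv"
abbreviation br :: "'a set \<Rightarrow> nat \<Rightarrow> bool list" where "br \<equiv> branch xs hv"

definition fixed :: "'a set \<Rightarrow> nat \<Rightarrow> 'a set" where
  "fixed T l = {elt j | j. j < l \<and> hv (br T j)}"

lemma elt_in: "l < 2 * n \<Longrightarrow> elt l \<in> U"
  by (auto simp: tested_element_def)

lemma fixed_Suc: "fixed T (Suc l) = (if hv (br T l) then insert (elt l) (fixed T l) else fixed T l)"
  by (auto simp: fixed_def less_Suc_eq)

lemma res_br_Suc:
  "res (br T (Suc l)) R = (if hv (br T l) then put (elt l \<in> T) (elt l) (res (br T l) R) else res (br T l) R)"
  by (auto simp: put_def)

text \<open>On its own branch every value forced is the value in \<open>T\<close>, whichever bit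
  records it. Hence the order of the steps disappears, and forcing commutes with unions and
  intersections.\<close>

lemma res_br: "res (br T l) R = (R - fixed T l) \<union> (T \<inter> fixed T l)"
proof (induction l)
  case (Suc l)
  show ?case unfolding res_br_Suc Suc fixed_Suc by (auto simp: put_def)
qed (simp add: fixed_def)

lemma res_br_mono: "R \<subseteq> R' \<Longrightarrow> res (br T l) R \<subseteq> res (br T l) R'"
  by (auto simp: res_br)

lemma res_br_subset: "T \<subseteq> U \<Longrightarrow> R \<subseteq> U \<Longrightarrow> res (br T l) R \<subseteq> U"
  by (auto simp: res_br)

lemma fixed_mono: "i \<le> l \<Longrightarrow> fixed T i \<subseteq> fixed T l"
  unfolding fixed_def by fastforce

lemma lower_mono: "i \<le> l \<Longrightarrow> res (br T i) {} \<subseteq> res (br T l) {}"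
  using fixed_mono[of i l T] by (auto simp: res_br)

lemma upper_antimono: "T \<subseteq> U \<Longrightarrow> i \<le> l \<Longrightarrow> res (br T l) U \<subseteq> res (br T i) U"
  using fixed_mono[of i l T] by (auto simp: res_br)

text \<open>A set that agrees with \<open>T\<close> on the fixed elements answers all heavy tests
  alike, so the arguments reaching a node form a subcube.\<close>

lemma br_res: "j \<le> l \<Longrightarrow> br (res (br T l) R) j = br T j"
proof (induction j)
  case (Suc j)
  have "elt j \<in> fixed T l" if "hv (br T j)" using that Suc.prems by (auto simp: fixed_def)
  then show ?case using Suc by (auto simp: res_br)
qed simp

text \<open>A \<open>False\<close> step changes nothing here: it deletes from a lower set an element
  outside \<open>T\<close>, or inserts into an upper set an element of \<open>T\<close> that is
  already there. So within a phase the value never drops.\<close>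

lemma raised_step:
  assumes "T \<subseteq> U" "l < 2 * n" "count_list (br T l) True \<le> K"
  defines "E \<equiv> extreme_set xs l"
  shows "(if hd (br T (Suc l)) then \<kappa> else 0) \<le> f (res (br T (Suc l)) E) - f (res (br T l) E)"
proof (cases "hd (br T (Suc l))")
  case True
  then show ?thesis using heavy[of "br T l"] assms by simp
next
  case False
  then have "hv (br T l) \<Longrightarrow> elt l \<in> T \<longleftrightarrow> \<not> l < n" by simp
  then have "res (br T (Suc l)) E = res (br T l) E"
    using assms(1) elt_in[OF assms(2)]
    unfolding res_br_Suc by (auto simp: put_def res_br E_def extreme_set_def)
  then show ?thesis using False by (simp del: force_path.simps branch.simps)
qed

lemma count_le_K: "real c * \<kappa> \<le> 2 \<Longrightarrow> c \<le> K"
  using \<kappa> by (metis dual_order.trans mult_le_cancel_right_pos of_nat_le_iff)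

lemma count_phase1:
  assumes "T \<subseteq> U" "l \<le> n"
  shows "real (count_list (br T l) True) * \<kappa> \<le> f (res (br T l) {}) - f {}"
  using assms(2)
proof (induction l)
  case (Suc l)
  then have IH: "real (count_list (br T l) True) * \<kappa> \<le> f (res (br T l) {}) - f {}" by simp
  also have "\<dots> \<le> 1" using range[OF res_br_subset[OF assms(1), of "{}" l]] range[of "{}"] by auto
  \<comment> \<open>The count bound so far is what licenses \<open>heavy\<close> at the next node;
    the induction thus establishes the cap \<open>K\<close> along with the rise.\<close>
  finally have "count_list (br T l) True \<le> K" by (intro count_le_K) simp
  from raised_step[OF assms(1) _ this] IH Suc.prems show ?case
    by (auto simp: extreme_set_def algebra_simps split: if_splits simp del: force_path.simps)
qed simp

text \<open>The tested set jumps from the lower to the upper one after step \<open>n\<close>, so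
  each phase telescopes separately; two rises of at most 1 explain the 2 in the hypothesis on
  \<open>K\<close>.\<close>

lemma count_phase2:
  assumes "T \<subseteq> U" "k \<le> n"
  shows "real (count_list (br T (n + k)) True) * \<kappa> \<le> 1 + f (res (br T (n + k)) U) - f (res (br T n) U)"
  using assms(2)
proof (induction k)
  case 0
  then show ?case
    using count_phase1[OF assms(1), of n] range[OF res_br_subset[OF assms(1), of "{}" n]] range[of "{}"] by auto
next
  case (Suc k)
  then have IH: "real (count_list (br T (n + k)) True) * \<kappa> \<le> 1 + f (res (br T (n + k)) U) - f (res (br T n) U)"
    by simp
  also have "\<dots> \<le> 2"
    using range[OF res_br_subset[OF assms(1), of U "n + k"]] range[OF res_br_subset[OF assms(1), of U n]] by auto
  finally have "count_list (br T (n + k)) True \<le> K" by (rule count_le_K)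
  from raised_step[OF assms(1) _ this] IH Suc.prems show ?case
    by (auto simp: extreme_set_def algebra_simps split: if_splits simp del: force_path.simps)
qed

lemma count_branch:
  assumes "T \<subseteq> U" "l \<le> 2 * n"
  shows "count_list (br T l) True \<le> K"
proof (rule count_le_K, cases "l \<le> n")
  case True
  then show "real (count_list (br T l) True) * \<kappa> \<le> 2"
    using count_phase1[OF assms(1) True] range[OF res_br_subset[OF assms(1), of "{}" l]] range[of "{}"] by auto
next
  case False
  then obtain k where "l = n + k" "k \<le> n" using assms by (metis add_le_cancel_left le_add_diff_inverse mult_2 nat_le_linear)
  then show "real (count_list (br T l) True) * \<kappa> \<le> 2"
    using count_phase2[OF assms(1), of k] range[OF res_br_subset[OF assms(1), of U l]]
      range[OF res_br_subset[OF assms(1), of U n]] by auto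
qed

lemma leaf_submodular:
  assumes "T \<subseteq> U"
  shows "submodular_on U (\<lambda>R. f (res (br T l) R))"
  unfolding submodular_on_def
proof (intro allI impI)
  fix R S assume "R \<subseteq> U" "S \<subseteq> U"
  moreover have "res (br T l) (R \<union> S) = res (br T l) R \<union> res (br T l) S"
    "res (br T l) (R \<inter> S) = res (br T l) R \<inter> res (br T l) S" by (auto simp: res_br)
  ultimately show "f (res (br T l) (R \<union> S)) + f (res (br T l) (R \<inter> S)) \<le> f (res (br T l) R) + f (res (br T l) S)"
    using submodular res_br_subset[OF assms] unfolding submodular_on_def by simp
qed

text \<open>An element left open had two light tests. The lower set \<open>A\<close> of the first
  lies in \<open>Y\<close>, and the upper set \<open>B\<close> of the second contains
  \<open>insert x Y\<close>, so the marginal at \<open>Y\<close> lies between those at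
  \<open>B - {x}\<close> and at \<open>A\<close>. A fixed element has marginal 0.\<close>

lemma leaf_marginal:
  assumes T: "T \<subseteq> U" and x: "x \<in> U" and R: "R \<subseteq> U - {x}"
  defines "L \<equiv> br T (2 * n)"
  shows "\<bar>f (res L (insert x R)) - f (res L R)\<bar> \<le> \<gamma>"
proof (cases "x \<in> fixed T (2 * n)")
  case True
  then have "res L (insert x R) = res L R" by (auto simp: L_def res_br)
  then show ?thesis using \<gamma> by simp
next
  case False
  define Y where "Y = res L R"
  have Y: "res L (insert x R) = insert x Y" "x \<notin> Y" "Y \<subseteq> U"
    using False R T by (auto simp: Y_def L_def res_br)
  obtain i where i: "i < n" "x = xs ! i" using x by (metis in_set_conv_nth)
  have e: "elt i = x" "elt (n + i) = x" using i by (auto simp: tested_element_def)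
  have "\<not> hv (br T i)" "\<not> hv (br T (n + i))" using False e i unfolding fixed_def by fastforce+
  note light' = light[OF _ count_branch[OF T] this(1)] light[OF _ count_branch[OF T] this(2)]
  define A where "A = res (br T i) {}"
  define B where "B = res (br T (n + i)) U"
  have "A \<subseteq> res L {}" using lower_mono i unfolding A_def L_def by auto
  also have "\<dots> \<subseteq> Y" unfolding Y_def L_def by (rule res_br_mono) simp
  finally have AY: "A \<subseteq> Y" .
  have "insert x Y \<subseteq> res L U" unfolding Y(1)[symmetric] L_def using R x by (intro res_br_mono) auto
  also have "\<dots> \<subseteq> B" using upper_antimono[OF T] i unfolding B_def L_def by auto
  finally have YB: "insert x Y \<subseteq> B" .
  have BU: "B \<subseteq> U" unfolding B_def by (rule res_br_subset[OF T]) simp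
  have "f (insert x A) - f A \<le> \<gamma>"
    using light'(1) i e by (simp add: A_def extreme_set_def put_def)
  moreover have "f (insert x Y) - f Y \<le> f (insert x A) - f A"
    using submodular_on_marginal[OF submodular AY Y(3) x Y(2)] .
  moreover have "f (B - {x}) - f B \<le> \<gamma>"
    using light'(2) i e by (simp add: B_def extreme_set_def put_def)
  moreover have "f (insert x (B - {x})) - f (B - {x}) \<le> f (insert x Y) - f Y"
    using YB Y(2) BU x by (intro submodular_on_marginal[OF submodular]) auto
  moreover have "insert x (B - {x}) = B" using YB by auto
  ultimately show ?thesis unfolding Y Y_def[symmetric] by (simp add: abs_le_iff)
qed

definition leaf_mean :: "('a \<Rightarrow> real) \<Rightarrow> 'a set \<Rightarrow> real" where
  "leaf_mean p T = mean U p (\<lambda>R. f (res (br T (2 * n)) R))"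

text \<open>Induction from the leaves to the root. The conditional distribution at a node is
  expressed as a fresh draw on \<open>U\<close> overwritten by \<open>res (br T l)\<close>; at the
  root nothing is overwritten.\<close>

lemma prob_far_from_leaf_mean:
  assumes p: "\<And>x. x \<in> U \<Longrightarrow> p x \<in> {0..1}" and t: "0 < t" "t \<le> 1"
  shows "measure_pmf.prob (product_distribution U p) {T. \<bar>f T - leaf_mean p T\<bar> > t}
    \<le> 2 * exp (- (3 * t\<^sup>2) / (16 * \<gamma>))" (is "_ \<le> ?\<eta>")
proof -
  let ?bad = "{T. \<bar>f T - leaf_mean p T\<bar> > t}"
  have "mean U p (\<lambda>R. indicator ?bad (res (br T l) R)) \<le> ?\<eta>" if "l \<le> 2 * n" "T \<subseteq> U" for T l
    using that
  proof (induction l arbitrary: T rule: inc_induct)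
    case base
    let ?F = "\<lambda>R. f (res (br T (2 * n)) R)"
    have "leaf_mean p (res (br T (2 * n)) R) = mean U p ?F" for R
      unfolding leaf_mean_def by (simp add: br_res)
    then have "(\<lambda>R. indicator ?bad (res (br T (2 * n)) R)) = (indicator {R. \<bar>?F R - mean U p ?F\<bar> > t} :: _ \<Rightarrow> real)"
      by (auto simp: fun_eq_iff indicator_def)
    then show ?case
      using submodular_tail[OF _ leaf_submodular[OF base] p range[OF res_br_subset[OF base]] leaf_marginal[OF base] \<gamma> t]
      by simp
  next
    case (step l)
    define x where "x = elt l"
    have x: "x \<in> U" using step.hyps by (simp add: x_def elt_in)
    show ?case
    proof (cases "hv (br T l)")
      case False
      then show ?thesis using step.IH[OF step.prems] by (simp add: res_br_Suc del: branch.simps)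
    next
      case True
      let ?\<phi> = "\<lambda>R. indicator ?bad (res (br T l) R) :: real"
      have half: "mean U p (\<lambda>R. ?\<phi> (put b x R)) \<le> ?\<eta>" for b
      proof -
        \<comment> \<open>An argument through the same node that represents the child chosen by
          \<open>b\<close>. If \<open>x\<close> was fixed earlier, both values of \<open>b\<close>
          lead to the same child, and overwriting \<open>x\<close> has no effect.\<close>
        define T' where "T' = res (br T l) (put b x {})"
        have "T' \<subseteq> U" unfolding T'_def by (rule res_br_subset[OF step.prems]) (use x in \<open>auto simp: put_def\<close>)
        moreover have "br T' l = br T l" unfolding T'_def by (simp add: br_res)
        then have "res (br T' (Suc l)) R = put (x \<in> T') x (res (br T l) R)" for R
          using True by (simp add: res_br_Suc x_def del: branch.simps)
        moreover have "put (x \<in> T') x (res (br T l) R) = res (br T l) (put b x R)" for R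
          unfolding T'_def by (auto simp: put_def res_br)
        ultimately show ?thesis using step.IH[of T'] by simp
      qed
      have px: "p x \<in> {0..1}" using p x by simp
      have "mean U p ?\<phi> = p x * mean U p (\<lambda>R. ?\<phi> (put True x R)) + (1 - p x) * mean U p (\<lambda>R. ?\<phi> (put False x R))"
        using mean_resample[where U = U and x = x and p = p and \<phi> = ?\<phi>, OF finite_set x px]
        by (simp add: put_def)
      also have "\<dots> \<le> p x * ?\<eta> + (1 - p x) * ?\<eta>"
        using px by (intro add_mono mult_left_mono half) auto
      also have "\<dots> = ?\<eta>" by (simp add: algebra_simps)
      finally show ?thesis .
    qed
  qed
  from this[of 0 "{}"] show ?thesis by simp
qed

end

section \<open>From small steps to distributions of final states\<close>

section \<open>Loop-free programs\<close>

primrec loop_free :: "com \<Rightarrow> bool" where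
  "loop_free SKIP \<longleftrightarrow> True"
| "loop_free (NConst a k) \<longleftrightarrow> True"
| "loop_free (NAdd a b c) \<longleftrightarrow> True"
| "loop_free (NSub a b c) \<longleftrightarrow> True"
| "loop_free (RConst a r) \<longleftrightarrow> True"
| "loop_free (RAdd a b c) \<longleftrightarrow> True"
| "loop_free (RSub a b c) \<longleftrightarrow> True"
| "loop_free (RMul a b c) \<longleftrightarrow> True"
| "loop_free (RDiv a b c) \<longleftrightarrow> True"
| "loop_free (Bernoulli a b) \<longleftrightarrow> True"
| "loop_free (Query a b) \<longleftrightarrow> True"
| "loop_free (Seq c d) \<longleftrightarrow> loop_free c \<and> loop_free d"
| "loop_free (Branch b c d) \<longleftrightarrow> loop_free c \<and> loop_free d"
| "loop_free (While b c) \<longleftrightarrow> False"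

primrec exec :: "'a list \<Rightarrow> 'a answers \<Rightarrow> com \<Rightarrow> 'a state \<Rightarrow> 'a state pmf" where
  "exec xs orc SKIP s = return_pmf s"
| "exec xs orc (NConst a k) s = map_pmf snd (step xs orc (NConst a k) s)"
| "exec xs orc (NAdd a b c) s = map_pmf snd (step xs orc (NAdd a b c) s)"
| "exec xs orc (NSub a b c) s = map_pmf snd (step xs orc (NSub a b c) s)"
| "exec xs orc (RConst a r) s = map_pmf snd (step xs orc (RConst a r) s)"
| "exec xs orc (RAdd a b c) s = map_pmf snd (step xs orc (RAdd a b c) s)"
| "exec xs orc (RSub a b c) s = map_pmf snd (step xs orc (RSub a b c) s)"
| "exec xs orc (RMul a b c) s = map_pmf snd (step xs orc (RMul a b c) s)"
| "exec xs orc (RDiv a b c) s = map_pmf snd (step xs orc (RDiv a b c) s)"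
| "exec xs orc (Bernoulli a b) s = map_pmf snd (step xs orc (Bernoulli a b) s)"
| "exec xs orc (Query a b) s = map_pmf snd (step xs orc (Query a b) s)"
| "exec xs orc (Seq c d) s = bind_pmf (exec xs orc c s) (exec xs orc d)"
| "exec xs orc (Branch b c d) s = (if holds b s then exec xs orc c s else exec xs orc d s)"
| "exec xs orc (While b c) s = return_pmf s"

lemma run_SKIP: "run xs orc t (SKIP, s) = return_pmf (SKIP, s)"
  by (induction t) (auto simp: bind_return_pmf)

text \<open>The extra 1 is the step that discards the finished \<open>SKIP\<close>. Some random
  outcomes may halt \<open>c\<close> before time \<open>k\<close>; the first hypothesis absorbs the
  time left over.\<close>

lemma run_Seq:
  assumes "\<And>s' t. T \<le> t \<Longrightarrow> run xs orc t (d, s') = run xs orc T (d, s')"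
    and "\<And>c' s'. (c', s') \<in> set_pmf (run xs orc k (c, s)) \<Longrightarrow> c' = SKIP"
    and "k + 1 + T \<le> t"
  shows "run xs orc t (Seq c d, s) = bind_pmf (run xs orc k (c, s)) (\<lambda>(_, s'). run xs orc T (d, s'))"
  using assms(2,3)
proof (induction k arbitrary: c s t)
  case 0
  then have "c = SKIP" by simp
  moreover obtain t' where t: "t = Suc t'" "T \<le> t'" using 0(2) by (cases t) auto
  ultimately show ?case using assms(1)[OF t(2), of s] by (simp add: bind_return_pmf)
next
  case (Suc k)
  obtain t' where t: "t = Suc t'" "k + 1 + T \<le> t'" using Suc.prems(2) by (cases t) auto
  show ?case
  proof (cases "c = SKIP")
    case True
    then show ?thesis
      using assms(1)[of t' s] t by (simp add: bind_return_pmf run_SKIP)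
  next
    case False
    have *: "run xs orc t' (Seq (fst cfg) d, snd cfg)
        = bind_pmf (run xs orc k cfg) (\<lambda>(_, s'). run xs orc T (d, s'))"
      if "cfg \<in> set_pmf (step xs orc c s)" for cfg
    proof -
      obtain c' s' where cfg: "cfg = (c', s')" by force
      show ?thesis unfolding cfg fst_conv snd_conv
      proof (rule Suc.IH[OF _ t(2)])
        fix c'' s'' assume "(c'', s'') \<in> set_pmf (run xs orc k (c', s'))"
        then have "(c'', s'') \<in> set_pmf (run xs orc (Suc k) (c, s))"
          using that unfolding cfg run.simps set_bind_pmf fst_conv snd_conv by blast
        then show "c'' = SKIP" by (rule Suc.prems(1))
      qed
    qed
    have "run xs orc t (Seq c d, s)
        = bind_pmf (step xs orc c s) (\<lambda>cfg. run xs orc t' (Seq (fst cfg) d, snd cfg))"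
      using False unfolding t(1) by (simp add: bind_map_pmf split_beta)
    also have "\<dots> = bind_pmf (step xs orc c s)
        (\<lambda>cfg. bind_pmf (run xs orc k cfg) (\<lambda>(_, s'). run xs orc T (d, s')))"
      using * by (rule bind_pmf_cong[OF refl])
    also have "\<dots> = bind_pmf (run xs orc (Suc k) (c, s)) (\<lambda>(_, s'). run xs orc T (d, s'))"
      by (simp add: bind_assoc_pmf)
    finally show ?thesis .
  qed
qed

text \<open>Without loops every step uses up program text, so the length of the text bounds the time
  for all random bits and all oracles.\<close>

lemma run_eq_exec:
  assumes "loop_free c" "com_length c \<le> t"
  shows "run xs orc t (c, s) = map_pmf (Pair SKIP) (exec xs orc c s)"
  using assms
proof (induction c arbitrary: t s)
  case (Seq c d)
  have "run xs orc t (Seq c d, s)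
      = bind_pmf (run xs orc (com_length c) (c, s)) (\<lambda>(_, s'). run xs orc (com_length d) (d, s'))"
    using Seq.prems by (intro run_Seq) (auto simp: Seq.IH)
  then show ?case
    using Seq by (simp add: map_pmf_def bind_assoc_pmf bind_return_pmf)
next
  case (Branch b c d)
  then obtain t' where "t = Suc t'" by (cases t) auto
  then show ?case using Branch by (auto simp: bind_return_pmf)
next
  case SKIP
  then show ?case by (simp add: run_SKIP)
qed (case_tac t; auto simp: bind_return_pmf run_SKIP map_pmf_def bind_assoc_pmf Let_def split_beta)+

primrec deterministic :: "com \<Rightarrow> bool" where
  "deterministic SKIP \<longleftrightarrow> True"
| "deterministic (NConst a k) \<longleftrightarrow> True"
| "deterministic (NAdd a b c) \<longleftrightarrow> True"
| "deterministic (NSub a b c) \<longleftrightarrow> True"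
| "deterministic (RConst a r) \<longleftrightarrow> True"
| "deterministic (RAdd a b c) \<longleftrightarrow> True"
| "deterministic (RSub a b c) \<longleftrightarrow> True"
| "deterministic (RMul a b c) \<longleftrightarrow> True"
| "deterministic (RDiv a b c) \<longleftrightarrow> True"
| "deterministic (Bernoulli a b) \<longleftrightarrow> False"
| "deterministic (Query a b) \<longleftrightarrow> True"
| "deterministic (Seq c d) \<longleftrightarrow> deterministic c \<and> deterministic d"
| "deterministic (Branch b c d) \<longleftrightarrow> deterministic c \<and> deterministic d"
| "deterministic (While b c) \<longleftrightarrow> False"

primrec result :: "'a list \<Rightarrow> 'a answers \<Rightarrow> com \<Rightarrow> 'a state \<Rightarrow> 'a state" where
  "result xs orc SKIP s = s"
| "result xs orc (NConst a k) s = nset a k s"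
| "result xs orc (NAdd a b c) s = nset a (nval s b + nval s c) s"
| "result xs orc (NSub a b c) s = nset a (nval s b - nval s c) s"
| "result xs orc (RConst a r) s = rset a r s"
| "result xs orc (RAdd a b c) s = rset a (rval s b + rval s c) s"
| "result xs orc (RSub a b c) s = rset a (rval s b - rval s c) s"
| "result xs orc (RMul a b c) s = rset a (rval s b * rval s c) s"
| "result xs orc (RDiv a b c) s = rset a (rval s b / rval s c) s"
| "result xs orc (Bernoulli a b) s = s"
| "result xs orc (Query a b) s =
     (let S = set_at xs s (addr s b) in (rset a (orc (queries s) S) s)\<lparr>queries := S # queries s\<rparr>)"
| "result xs orc (Seq c d) s = result xs orc d (result xs orc c s)"
| "result xs orc (Branch b c d) s = (if holds b s then result xs orc c s else result xs orc d s)"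
| "result xs orc (While b c) s = s"

lemma exec_deterministic: "deterministic c \<Longrightarrow> exec xs orc c s = return_pmf (result xs orc c s)"
  by (induction c arbitrary: s) (auto simp: bind_return_pmf Let_def)

lemma loop_free_if_deterministic: "deterministic c \<Longrightarrow> loop_free c"
  by (induction c) auto

definition seqs :: "com list \<Rightarrow> com" where
  "seqs cs = foldr Seq cs SKIP"

lemma seqs_simps [simp]: "seqs [] = SKIP" "seqs (c # cs) = Seq c (seqs cs)"
  by (simp_all add: seqs_def)

lemma loop_free_seqs [simp]: "loop_free (seqs cs) \<longleftrightarrow> (\<forall>c\<in>set cs. loop_free c)"
  by (induction cs) auto

lemma deterministic_seqs [simp]: "deterministic (seqs cs) \<longleftrightarrow> (\<forall>c\<in>set cs. deterministic c)"
  by (induction cs) auto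

lemma com_length_seqs: "com_length (seqs cs) = Suc (\<Sum>c\<leftarrow>cs. Suc (com_length c))"
  by (induction cs) auto

lemma com_length_seqs_le:
  assumes "\<And>c. c \<in> set cs \<Longrightarrow> com_length c \<le> k"
  shows "com_length (seqs cs) \<le> Suc (length cs * Suc k)"
  using assms
proof (induction cs)
  case (Cons c cs)
  have "com_length c \<le> k" "com_length (seqs cs) \<le> Suc (length cs * Suc k)" using Cons by auto
  then show ?case by simp
qed simp

section \<open>Sparse paths, memory layout, and the code of the learner and the evaluator\<close>

section \<open>The programs\<close>

fun paths :: "nat \<Rightarrow> nat \<Rightarrow> bool list list" where
  "paths K 0 = [[]]"
| "paths 0 (Suc l) = map (Cons False) (paths 0 l)"
| "paths (Suc K) (Suc l) = map (Cons False) (paths (Suc K) l) @ map (Cons True) (paths K l)"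

lemma set_paths: "set (paths K l) = {\<pi>. length \<pi> = l \<and> count_list \<pi> True \<le> K}"
proof (induction K l rule: paths.induct)
  case (2 l)
  have "\<pi> \<in> Cons False ` {\<pi>. length \<pi> = l \<and> count_list \<pi> True \<le> 0}"
    if "length \<pi> = Suc l" "count_list \<pi> True \<le> 0" for \<pi>
    using that by (cases \<pi>) (auto split: if_splits)
  then show ?case using 2 by auto
next
  case (3 K l)
  have "\<pi> \<in> Cons False ` {\<pi>. length \<pi> = l \<and> count_list \<pi> True \<le> Suc K} \<union> Cons True ` {\<pi>. length \<pi> = l \<and> count_list \<pi> True \<le> K}"
    if "length \<pi> = Suc l" "count_list \<pi> True \<le> Suc K" for \<pi>
    using that by (cases \<pi>) (auto split: if_splits)
  then show ?case using 3 by auto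
qed auto

text \<open>The first two terms of the binomial expansion of \<open>Suc (Suc x) ^ Suc k\<close>
  around \<open>Suc x\<close>. It solves the Pascal-like recursions for the number of paths and for
  the size of the evaluator.\<close>

lemma Suc_power_step: "Suc x ^ Suc k + Suc k * Suc x ^ k \<le> Suc (Suc x) ^ Suc k"
proof (induction k)
  case (Suc k)
  have "Suc x ^ Suc (Suc k) + Suc (Suc k) * Suc x ^ Suc k
      \<le> Suc (Suc x) * (Suc x ^ Suc k + Suc k * Suc x ^ k)"
    by (simp add: algebra_simps)
  also have "\<dots> \<le> Suc (Suc x) * Suc (Suc x) ^ Suc k" using Suc by (intro mult_left_mono) auto
  finally show ?case by simp
qed simp

lemma length_paths: "length (paths K l) \<le> Suc l ^ K"
proof (induction K l rule: paths.induct)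
  case (3 K l)
  have "length (paths (Suc K) (Suc l)) \<le> Suc l ^ Suc K + Suc K * Suc l ^ K"
    using 3 by (simp add: algebra_simps)
  then show ?case using Suc_power_step[of l K] by linarith
qed auto

text \<open>
  With \<open>n = length xs\<close>, the natural-number cells below \<open>n\<close> receive the argument of the evaluator,
  the next \<open>n\<close> cells form the working block, two more cells hold a zero and a flag, and the
  blocks from \<open>sample_block n 0\<close> on hold the random sets. The real cells below \<open>n\<close> hold the
  inclusion probabilities.
\<close>

definition sample_block :: "nat \<Rightarrow> nat \<Rightarrow> nat" where "sample_block n k = 2 * n + 2 + k * n"

text \<open>\<open>to_nat\<close> gives every path its own address. Offsets 0, 1, 2 modulo 4
  separate the three kinds of cells, and offset 3 is free for scratch. Addresses may be huge, but an
  access costs one step.\<close>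

definition threshold_cell :: "nat \<Rightarrow> bool list \<Rightarrow> nat" where "threshold_cell n \<pi> = n + 4 * to_nat \<pi>"
definition answer_cell :: "nat \<Rightarrow> bool list \<Rightarrow> nat" where "answer_cell n \<pi> = n + 4 * to_nat \<pi> + 1"
definition average_cell :: "nat \<Rightarrow> bool list \<Rightarrow> nat" where "average_cell n \<pi> = n + 4 * to_nat \<pi> + 2"
definition scratch_cell :: "nat \<Rightarrow> nat" where "scratch_cell n = n + 3"

lemma cells_distinct [simp]:
  "threshold_cell n \<pi> = threshold_cell n \<sigma> \<longleftrightarrow> \<pi> = \<sigma>"
  "answer_cell n \<pi> = answer_cell n \<sigma> \<longleftrightarrow> \<pi> = \<sigma>"
  "average_cell n \<pi> = average_cell n \<sigma> \<longleftrightarrow> \<pi> = \<sigma>"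
  "threshold_cell n \<pi> \<noteq> answer_cell n \<sigma>" "answer_cell n \<sigma> \<noteq> threshold_cell n \<pi>"
  "threshold_cell n \<pi> \<noteq> average_cell n \<sigma>" "average_cell n \<sigma> \<noteq> threshold_cell n \<pi>"
  "answer_cell n \<pi> \<noteq> average_cell n \<sigma>" "average_cell n \<sigma> \<noteq> answer_cell n \<pi>"
  "threshold_cell n \<pi> \<noteq> scratch_cell n" "scratch_cell n \<noteq> threshold_cell n \<pi>"
  "answer_cell n \<pi> \<noteq> scratch_cell n" "scratch_cell n \<noteq> answer_cell n \<pi>"
  "average_cell n \<pi> \<noteq> scratch_cell n" "scratch_cell n \<noteq> average_cell n \<pi>"
  unfolding threshold_cell_def answer_cell_def average_cell_def scratch_cell_def by (simp; presburger?)+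

lemma cells_ge: "n \<le> threshold_cell n \<pi>" "n \<le> answer_cell n \<pi>" "n \<le> scratch_cell n"
  by (simp_all add: threshold_cell_def answer_cell_def average_cell_def scratch_cell_def)

definition position :: "nat \<Rightarrow> nat \<Rightarrow> nat" where
  "position n l = (if l < n then l else l - n)"

definition heavy_at :: "nat \<Rightarrow> (nat \<Rightarrow> real) \<Rightarrow> bool list \<Rightarrow> bool" where
  "heavy_at n \<rho> \<pi> \<longleftrightarrow> \<rho> (threshold_cell n \<pi>) < \<rho> (answer_cell n \<pi>)"

definition heavy_cond :: "nat \<Rightarrow> bool list \<Rightarrow> cond" where
  "heavy_cond n \<pi> = RLess (Direct (threshold_cell n \<pi>)) (Direct (answer_cell n \<pi>))"

definition put_cell :: "nat \<Rightarrow> bool \<Rightarrow> nat \<Rightarrow> com" where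
  "put_cell n b l = NConst (Direct (n + position n l)) (if b then 1 else 0)"

text \<open>Carries out \<open>force_path\<close> on the working block. The path is built into the
  code, while heaviness is looked up at run time in the cells of the shorter paths.\<close>

primrec replay :: "nat \<Rightarrow> bool list \<Rightarrow> com" where
  "replay n [] = SKIP"
| "replay n (b # \<pi>) = Seq (replay n \<pi>)
     (if b then put_cell n (length \<pi> < n) (length \<pi>)
      else Branch (heavy_cond n \<pi>) (put_cell n (\<not> length \<pi> < n) (length \<pi>)) SKIP)"

definition fill :: "nat \<Rightarrow> nat \<Rightarrow> com" where
  "fill n v = seqs (map (\<lambda>i. NConst (Direct (n + i)) v) [0..<n])"

definition node :: "nat \<Rightarrow> real \<Rightarrow> bool list \<Rightarrow> com" where
  "node n \<theta> \<pi> = seqs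
     [fill n (if length \<pi> < n then 0 else 1), replay n \<pi>,
      Query (Direct (threshold_cell n \<pi>)) (Direct n),
      put_cell n (length \<pi> < n) (length \<pi>),
      Query (Direct (answer_cell n \<pi>)) (Direct n),
      RConst (Direct (scratch_cell n)) \<theta>,
      RAdd (Direct (threshold_cell n \<pi>)) (Direct (threshold_cell n \<pi>)) (Direct (scratch_cell n))]"

definition tree_command :: "nat \<Rightarrow> nat \<Rightarrow> real \<Rightarrow> nat \<Rightarrow> com" where
  "tree_command n K \<theta> L = seqs (map (\<lambda>l. seqs (map (node n \<theta>) (paths K l))) [0..<L])"

definition draw_sample :: "nat \<Rightarrow> nat \<Rightarrow> com" where
  "draw_sample n b = seqs (map (\<lambda>i. Bernoulli (Direct (b + i)) (Direct i)) [0..<n])"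

definition sample_command :: "nat \<Rightarrow> nat \<Rightarrow> com" where
  "sample_command n m = seqs (map (\<lambda>k. draw_sample n (sample_block n k)) [0..<m])"

definition copy_sample :: "nat \<Rightarrow> nat \<Rightarrow> com" where
  "copy_sample n k = seqs (map (\<lambda>i. Seq (NConst (Direct (n + i)) 0)
     (NAdd (Direct (n + i)) (Direct (n + i)) (Direct (sample_block n k + i)))) [0..<n])"

definition leaf_round :: "nat \<Rightarrow> bool list \<Rightarrow> nat \<Rightarrow> com" where
  "leaf_round n \<pi> k = seqs
     [copy_sample n k, replay n \<pi>, Query (Direct (scratch_cell n)) (Direct n),
      RAdd (Direct (average_cell n \<pi>)) (Direct (average_cell n \<pi>)) (Direct (scratch_cell n))]"

definition leaf_command :: "nat \<Rightarrow> nat \<Rightarrow> bool list \<Rightarrow> com" where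
  "leaf_command n m \<pi> = seqs
     [RConst (Direct (average_cell n \<pi>)) 0,
      seqs (map (leaf_round n \<pi>) [0..<m]),
      RConst (Direct (scratch_cell n)) (real m),
      RDiv (Direct (average_cell n \<pi>)) (Direct (average_cell n \<pi>)) (Direct (scratch_cell n))]"

definition learn_command :: "nat \<Rightarrow> nat \<Rightarrow> real \<Rightarrow> nat \<Rightarrow> com" where
  "learn_command n K \<theta> m = Seq (tree_command n K \<theta> (2 * n))
     (Seq (sample_command n m) (seqs (map (leaf_command n m) (paths K (2 * n)))))"

text \<open>Heaviness and membership are merged into one flag so that the code of each subtree is
  written once; nested branches would repeat the \<open>False\<close> subtree. Cell
  \<open>2 * n\<close> holds 0 because the only condition on naturals is a strict
  comparison.\<close>

definition flag_command :: "nat \<Rightarrow> bool list \<Rightarrow> com" where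
  "flag_command n \<pi> = seqs
     [NConst (Direct (2 * n)) 0, NConst (Direct (2 * n + 1)) 0,
      Branch (heavy_cond n \<pi>)
        (Branch (NLess (Direct (2 * n)) (Direct (position n (length \<pi>))))
          (NConst (Direct (2 * n + 1)) (if length \<pi> < n then 1 else 0))
          (NConst (Direct (2 * n + 1)) (if length \<pi> < n then 0 else 1)))
        SKIP]"

text \<open>The argument \<open>K\<close> counts the \<open>True\<close> steps that are still possible.\<close>

fun eval_command :: "nat \<Rightarrow> nat \<Rightarrow> nat \<Rightarrow> bool list \<Rightarrow> com" where
  "eval_command n K 0 \<pi> =
     Seq (RConst (Direct 0) 0) (RAdd (Direct 0) (Direct 0) (Direct (average_cell n \<pi>)))"
| "eval_command n 0 (Suc k) \<pi> = eval_command n 0 k (False # \<pi>)"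
| "eval_command n (Suc K) (Suc k) \<pi> = Seq (flag_command n \<pi>)
     (Branch (NLess (Direct (2 * n)) (Direct (2 * n + 1)))
       (eval_command n K k (True # \<pi>)) (eval_command n (Suc K) k (False # \<pi>)))"

section \<open>Code length: polynomial in \<open>n\<close> with exponent \<open>K\<close> plus a
  constant\<close>

section \<open>Length of the programs\<close>

lemma deterministic_replay [simp]: "deterministic (replay n \<pi>)"
  by (induction \<pi>) (auto simp: put_cell_def)

lemma deterministic_fill [simp]: "deterministic (fill n v)"
  by (auto simp: fill_def)

lemma deterministic_tree [simp]: "deterministic (tree_command n K \<theta> L)"
  by (auto simp: tree_command_def node_def put_cell_def)

lemma deterministic_leaf [simp]: "deterministic (leaf_command n m \<pi>)"
  by (auto simp: leaf_command_def leaf_round_def copy_sample_def)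

lemma loop_free_learn: "loop_free (learn_command n K \<theta> m)"
  by (auto simp: learn_command_def sample_command_def draw_sample_def loop_free_if_deterministic)

lemma deterministic_eval: "deterministic (eval_command n K k \<pi>)"
  by (induction n K k \<pi> rule: eval_command.induct) (auto simp: flag_command_def)

lemma query_free_eval: "query_free (eval_command n K k \<pi>)"
  by (induction n K k \<pi> rule: eval_command.induct) (auto simp: flag_command_def)

lemma com_length_put_cell [simp]: "com_length (put_cell n b l) = 1"
  by (simp add: put_cell_def)

lemma com_length_replay: "com_length (replay n \<pi>) \<le> 1 + 4 * length \<pi>"
  by (induction \<pi>) auto

lemma com_length_fill: "com_length (fill n v) = 1 + 2 * n"
  by (simp add: fill_def com_length_seqs o_def sum_list_triv)

lemma com_length_copy: "com_length (copy_sample n k) = 1 + 4 * n"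
  by (simp add: copy_sample_def com_length_seqs o_def sum_list_triv)

lemma com_length_node: "length \<pi> \<le> 2 * n \<Longrightarrow> com_length (node n \<theta> \<pi>) \<le> 15 + 10 * n"
  using com_length_replay[of n \<pi>] by (simp add: node_def com_length_fill)

lemma com_length_tree:
  assumes "L \<le> 2 * n"
  shows "com_length (tree_command n K \<theta> L) \<le> 1 + L * (2 + Suc L ^ K * (16 + 10 * n))"
proof -
  have "com_length (seqs (map (node n \<theta>) (paths K l))) \<le> 1 + Suc L ^ K * (16 + 10 * n)" if "l < L" for l
  proof -
    have "com_length (seqs (map (node n \<theta>) (paths K l))) \<le> Suc (length (map (node n \<theta>) (paths K l)) * Suc (15 + 10 * n))"
      using that assms by (intro com_length_seqs_le) (auto simp: set_paths intro!: com_length_node)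
    also have "\<dots> \<le> 1 + Suc L ^ K * (16 + 10 * n)"
      using mult_le_mono1[OF order_trans[OF length_paths[of K l] power_mono[of "Suc l" "Suc L" K]], of "16 + 10 * n"] that
      by (simp add: algebra_simps)
    finally show ?thesis .
  qed
  then have "com_length (tree_command n K \<theta> L)
      \<le> Suc (length (map (\<lambda>l. seqs (map (node n \<theta>) (paths K l))) [0..<L]) * Suc (1 + Suc L ^ K * (16 + 10 * n)))"
    unfolding tree_command_def by (intro com_length_seqs_le) auto
  then show ?thesis by simp
qed

lemma com_length_samples: "com_length (sample_command n m) = 1 + m * (2 + 2 * n)"
  by (simp add: sample_command_def draw_sample_def com_length_seqs o_def sum_list_triv)

lemma com_length_leaf:
  assumes "length \<pi> = 2 * n"
  shows "com_length (leaf_command n m \<pi>) \<le> 10 + m * (10 + 12 * n)"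
proof -
  have "com_length (leaf_round n \<pi> k) \<le> 9 + 12 * n" for k
    using com_length_replay[of n \<pi>] assms by (simp add: leaf_round_def com_length_copy)
  then have "com_length (seqs (map (leaf_round n \<pi>) [0..<m])) \<le> Suc (length (map (leaf_round n \<pi>) [0..<m]) * Suc (9 + 12 * n))"
    by (intro com_length_seqs_le) auto
  then show ?thesis by (simp add: leaf_command_def)
qed

lemma com_length_learn:
  "com_length (learn_command n K \<theta> m)
     \<le> 1 + 2 * n * (2 + Suc (2 * n) ^ K * (16 + 10 * n)) + (3 + m * (2 + 2 * n))
       + (2 + Suc (2 * n) ^ K * (11 + m * (10 + 12 * n)))"
proof -
  have "com_length (seqs (map (leaf_command n m) (paths K (2 * n))))
      \<le> Suc (length (map (leaf_command n m) (paths K (2 * n))) * Suc (10 + m * (10 + 12 * n)))"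
    by (intro com_length_seqs_le) (auto simp: set_paths intro!: com_length_leaf)
  also have "\<dots> \<le> 1 + Suc (2 * n) ^ K * (11 + m * (10 + 12 * n))"
    using mult_le_mono1[OF length_paths[of K "2 * n"], of "11 + m * (10 + 12 * n)"]
    by (simp add: algebra_simps)
  finally show ?thesis
    using com_length_tree[of "2 * n" n K \<theta>] by (simp add: learn_command_def com_length_samples)
qed

text \<open>A node costs at most 20 besides its two subtrees, one with a smaller budget; budget 0
  produces only the code of a leaf. The additive terms fit under \<open>Suc_power_step\<close>
  because the factor \<open>Suc (Suc K)\<close> is at least 2.\<close>

lemma com_length_eval: "com_length (eval_command n K k \<pi>) \<le> 20 * Suc k ^ Suc K"
proof (induction n K k \<pi> rule: eval_command.induct)
  case (3 n K k \<pi>)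
  have "com_length (flag_command n \<pi>) \<le> 15" by (simp add: flag_command_def)
  then have "com_length (eval_command n (Suc K) (Suc k) \<pi>) \<le> 20 + 20 * Suc k ^ Suc K + 20 * Suc k ^ Suc (Suc K)"
    using 3 by simp
  also have "\<dots> \<le> 20 * (Suc k ^ Suc (Suc K) + Suc (Suc K) * Suc k ^ Suc K)"
  proof -
    have "1 \<le> Suc k ^ Suc K" by (rule one_le_power) simp
    then have "20 + 20 * Suc k ^ Suc K \<le> 40 * Suc k ^ Suc K" by linarith
    also have "\<dots> \<le> 20 * (Suc (Suc K) * Suc k ^ Suc K)" by simp
    finally have "20 + 20 * Suc k ^ Suc K \<le> 20 * (Suc (Suc K) * Suc k ^ Suc K)" .
    from add_right_mono[OF this, of "20 * Suc k ^ Suc (Suc K)"] show ?thesis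
      by (simp only: distrib_left add.commute)
  qed
  also have "\<dots> \<le> 20 * Suc (Suc k) ^ Suc (Suc K)" by (rule mult_left_mono[OF Suc_power_step]) simp
  finally show ?case .
qed auto

section \<open>Memory invariants of the deterministic code, for adaptive oracles\<close>

section \<open>Effect of the programs\<close>

lemma result_seqs_append [simp]: "result xs orc (seqs (cs @ ds)) s = result xs orc (seqs ds) (result xs orc (seqs cs) s)"
  by (induction cs arbitrary: s) auto

lemma exec_seqs_append: "exec xs orc (seqs (cs @ ds)) s = bind_pmf (exec xs orc (seqs cs) s) (exec xs orc (seqs ds))"
  by (induction cs arbitrary: s) (auto simp: bind_return_pmf bind_assoc_pmf intro!: bind_pmf_cong)

lemma nset_Direct [simp]: "nset (Direct a) v s = s\<lparr>nmem := (nmem s)(a := v)\<rparr>"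
  by (simp add: nset_def)

lemma rset_Direct [simp]: "rset (Direct a) v s = s\<lparr>rmem := (rmem s)(a := v)\<rparr>"
  by (simp add: rset_def)

lemma set_at_cong: "(\<And>i. i < length xs \<Longrightarrow> nmem s (k + i) = nmem s' (k + i)) \<Longrightarrow> set_at xs s k = set_at xs s' k"
  unfolding set_at_def by auto

text \<open>Replaying a path overwrites the working block; the random sets lie above it and must
  survive until all leaves have been averaged.\<close>

definition same_outside_block :: "nat \<Rightarrow> 'a state \<Rightarrow> 'a state \<Rightarrow> bool" where
  "same_outside_block n s s' \<longleftrightarrow> (\<forall>a. a < n \<or> 2 * n \<le> a \<longrightarrow> nmem s' a = nmem s a)"

lemma same_outside_block_trans:
  "same_outside_block n s s' \<Longrightarrow> same_outside_block n s' s'' \<Longrightarrow> same_outside_block n s s''"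
  by (simp add: same_outside_block_def)

context
  fixes xs :: "'a list" and orc :: "'a answers"
  assumes distinct: "distinct xs"
begin

lemma put_cell_effect:
  fixes s :: "'a state" and b
  assumes "l < 2 * length xs"
  defines "s' \<equiv> result xs orc (put_cell (length xs) b l) s"
  shows "rmem s' = rmem s" "same_outside_block (length xs) s s'"
    and "set_at xs s' (length xs) = put b (tested_element xs l) (set_at xs s (length xs))"
proof -
  have i: "position (length xs) l < length xs" using assms(1) by (auto simp: position_def)
  have e: "tested_element xs l = xs ! position (length xs) l" by (auto simp: tested_element_def position_def)
  show "rmem s' = rmem s" "same_outside_block (length xs) s s'"
    using i by (auto simp: s'_def put_cell_def same_outside_block_def)
  show "set_at xs s' (length xs) = put b (tested_element xs l) (set_at xs s (length xs))"
    using i distinct unfolding e s'_def put_cell_def put_def set_at_def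
    by (auto simp: nth_eq_iff_index_eq)
qed

lemma replay_effect:
  fixes s :: "'a state"
  assumes "length \<pi> \<le> 2 * length xs"
  defines "s' \<equiv> result xs orc (replay (length xs) \<pi>) s"
  shows "rmem s' = rmem s \<and> same_outside_block (length xs) s s' \<and>
    set_at xs s' (length xs) = force_path xs (heavy_at (length xs) (rmem s)) \<pi> (set_at xs s (length xs))"
  unfolding s'_def using assms(1)
proof (induction \<pi>)
  case Nil
  then show ?case by (simp add: same_outside_block_def)
next
  case (Cons b \<pi>)
  define s1 where "s1 = result xs orc (replay (length xs) \<pi>) s"
  have IH: "rmem s1 = rmem s" "same_outside_block (length xs) s s1"
    "set_at xs s1 (length xs) = force_path xs (heavy_at (length xs) (rmem s)) \<pi> (set_at xs s (length xs))"
    using Cons by (auto simp: s1_def)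
  have l: "length \<pi> < 2 * length xs" using Cons.prems by simp
  have c: "holds (heavy_cond (length xs) \<pi>) s1 \<longleftrightarrow> heavy_at (length xs) (rmem s) \<pi>"
    using IH(1) by (simp add: heavy_cond_def heavy_at_def)
  note p = put_cell_effect[OF l, where s = s1 and b = "length \<pi> < length xs"]
    put_cell_effect[OF l, where s = s1 and b = "\<not> length \<pi> < length xs"]
  show ?case
    using IH p same_outside_block_trans[OF IH(2)] by (auto simp: s1_def[symmetric] c simp del: not_less)
qed

lemma fill_effect:
  fixes s :: "'a state" and v
  defines "s' \<equiv> result xs orc (fill (length xs) v) s"
  shows "rmem s' = rmem s" "same_outside_block (length xs) s s'" "set_at xs s' (length xs) = (if v = 0 then {} else set xs)"
proof -
  have "result xs orc (seqs (map (\<lambda>i. NConst (Direct (length xs + i)) v) [0..<j])) s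
      = s\<lparr>nmem := (\<lambda>a. if length xs \<le> a \<and> a < length xs + j then v else nmem s a)\<rparr>" for j
    by (induction j) (auto simp: fun_eq_iff)
  then have s': "s' = s\<lparr>nmem := (\<lambda>a. if length xs \<le> a \<and> a < length xs + length xs then v else nmem s a)\<rparr>"
    by (simp add: s'_def fill_def)
  show "rmem s' = rmem s" "same_outside_block (length xs) s s'" by (auto simp: s' same_outside_block_def)
  have "nmem s' (length xs + i) = v" if "i < length xs" for i using that by (simp add: s')
  then show "set_at xs s' (length xs) = (if v = 0 then {} else set xs)"
    unfolding set_at_def set_conv_nth by auto
qed

lemma copy_sample_effect:
  fixes s :: "'a state" and k
  defines "s' \<equiv> result xs orc (copy_sample (length xs) k) s"
  shows "rmem s' = rmem s" "same_outside_block (length xs) s s'" "set_at xs s' (length xs) = set_at xs s (sample_block (length xs) k)"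
proof -
  define b where "b = sample_block (length xs) k"
  have b: "2 * length xs \<le> b" by (simp add: b_def sample_block_def)
  have "result xs orc (seqs (map (\<lambda>i. Seq (NConst (Direct (length xs + i)) 0)
        (NAdd (Direct (length xs + i)) (Direct (length xs + i)) (Direct (b + i)))) [0..<j])) s
      = s\<lparr>nmem := (\<lambda>a. if length xs \<le> a \<and> a < length xs + j then nmem s (b + (a - (length xs))) else nmem s a)\<rparr>"
    if "j \<le> length xs" for j
    using that
  proof (induction j)
    case (Suc j)
    have "(\<lambda>a. if length xs \<le> a \<and> a < length xs + j then nmem s (b + (a - (length xs))) else nmem s a)(length xs + j := nmem s (b + j))
        = (\<lambda>a. if length xs \<le> a \<and> a < length xs + Suc j then nmem s (b + (a - (length xs))) else nmem s a)"
      by (auto simp: fun_eq_iff)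
    then show ?case using Suc b by simp
  next
    case 0
    have "(\<lambda>a. if length xs \<le> a \<and> a < length xs + 0 then nmem s (b + (a - (length xs))) else nmem s a) = nmem s"
      by (auto simp: fun_eq_iff)
    then show ?case by simp
  qed
  then have s': "s' = s\<lparr>nmem := (\<lambda>a. if length xs \<le> a \<and> a < length xs + length xs then nmem s (b + (a - (length xs))) else nmem s a)\<rparr>"
    by (simp add: s'_def copy_sample_def b_def)
  show "rmem s' = rmem s" "same_outside_block (length xs) s s'" by (auto simp: s' same_outside_block_def)
  show "set_at xs s' (length xs) = set_at xs s (sample_block (length xs) k)" by (auto simp: s' set_at_def b_def)
qed

lemma set_at_subset: "set_at xs s k \<subseteq> set xs"
  by (auto simp: set_at_def)

lemma force_path_subset: "length \<pi> \<le> 2 * length xs \<Longrightarrow> R \<subseteq> set xs \<Longrightarrow> force_path xs hv \<pi> R \<subseteq> set xs"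
  by (induction \<pi>) (auto simp: put_def tested_element_def)

context
  fixes f :: "'a set \<Rightarrow> real" and \<tau> :: real
  assumes tolerant: "tolerant_oracle (set xs) f \<tau> orc"
begin

lemma oracle_bound: "S \<subseteq> set xs \<Longrightarrow> \<bar>orc qs S - f S\<bar> \<le> \<tau>"
  using tolerant by (simp add: tolerant_oracle_def)

definition node_correct :: "real \<Rightarrow> (nat \<Rightarrow> real) \<Rightarrow> bool list \<Rightarrow> bool" where
  "node_correct \<theta> \<rho> \<pi> \<longleftrightarrow>
     \<bar>\<rho> (threshold_cell (length xs) \<pi>) - \<theta> - f (force_path xs (heavy_at (length xs) \<rho>) \<pi> (extreme_set xs (length \<pi>)))\<bar> \<le> \<tau> \<and>
     \<bar>\<rho> (answer_cell (length xs) \<pi>) - f (force_path xs (heavy_at (length xs) \<rho>) (True # \<pi>) (extreme_set xs (length \<pi>)))\<bar> \<le> \<tau>"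

text \<open>The sets queried at \<pi> depend on memory only through the heaviness of proper
  suffixes, which are shorter. Hence later writes for other paths of the same or a greater length
  preserve correctness, and the tree can be built level by level.\<close>

lemma node_correct_cong:
  assumes "\<And>\<sigma>. \<sigma> = \<pi> \<or> length \<sigma> < length \<pi> \<Longrightarrow>
    \<rho> (threshold_cell (length xs) \<sigma>) = \<rho>' (threshold_cell (length xs) \<sigma>) \<and> \<rho> (answer_cell (length xs) \<sigma>) = \<rho>' (answer_cell (length xs) \<sigma>)"
  shows "node_correct \<theta> \<rho> \<pi> \<longleftrightarrow> node_correct \<theta> \<rho>' \<pi>"
proof -
  have "force_path xs (heavy_at (length xs) \<rho>) \<pi> R = force_path xs (heavy_at (length xs) \<rho>') \<pi> R" for R
    using assms by (intro force_path_cong) (auto simp: heavy_at_def)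
  then show ?thesis using assms[of \<pi>] by (simp add: node_correct_def)
qed

lemma node_effect:
  fixes s :: "'a state" and \<theta>
  assumes l: "length \<pi> < 2 * length xs"
  defines "s' \<equiv> result xs orc (node (length xs) \<theta> \<pi>) s"
  shows "a \<noteq> threshold_cell (length xs) \<pi> \<Longrightarrow> a \<noteq> answer_cell (length xs) \<pi> \<Longrightarrow> a \<noteq> scratch_cell (length xs) \<Longrightarrow> rmem s' a = rmem s a"
    and "node_correct \<theta> (rmem s') \<pi>"
proof -
  let ?hv = "heavy_at (length xs) (rmem s)" and ?E = "extreme_set xs (length \<pi>)"
  define s1 where "s1 = result xs orc (fill (length xs) (if length \<pi> < length xs then 0 else 1)) s"
  define s2 where "s2 = result xs orc (replay (length xs) \<pi>) s1"
  define s3 where "s3 = result xs orc (Query (Direct (threshold_cell (length xs) \<pi>)) (Direct (length xs))) s2"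
  define s4 where "s4 = result xs orc (put_cell (length xs) (length \<pi> < length xs) (length \<pi>)) s3"
  define s5 where "s5 = result xs orc (Query (Direct (answer_cell (length xs) \<pi>)) (Direct (length xs))) s4"
  have s1: "rmem s1 = rmem s" "set_at xs s1 (length xs) = ?E"
    using fill_effect[where s = s and v = "if length \<pi> < length xs then 0 else 1"]
    by (simp_all add: s1_def extreme_set_def)
  have s2: "rmem s2 = rmem s" "set_at xs s2 (length xs) = force_path xs ?hv \<pi> ?E"
    using replay_effect[where \<pi> = \<pi> and s = s1] l s1 by (simp_all add: s2_def)
  define u where "u = orc (queries s2) (set_at xs s2 (length xs))"
  have s3: "rmem s3 = (rmem s)(threshold_cell (length xs) \<pi> := u)"
    unfolding s3_def using s2(1) by (simp add: Let_def u_def)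
  have "nmem s3 = nmem s2" by (simp add: s3_def Let_def)
  then have "set_at xs s3 (length xs) = set_at xs s2 (length xs)" by (intro set_at_cong) simp
  then have s4: "rmem s4 = rmem s3" "set_at xs s4 (length xs) = force_path xs ?hv (True # \<pi>) ?E"
    using put_cell_effect[OF l, where s = s3 and b = "length \<pi> < length xs"] s2 by (simp_all add: s4_def)
  define v where "v = orc (queries s4) (set_at xs s4 (length xs))"
  have s5: "rmem s5 = (rmem s)(threshold_cell (length xs) \<pi> := u, answer_cell (length xs) \<pi> := v)"
    unfolding s5_def using s4(1) s3 by (simp add: Let_def v_def)
  have s': "rmem s' = (rmem s)(threshold_cell (length xs) \<pi> := u + \<theta>, answer_cell (length xs) \<pi> := v, scratch_cell (length xs) := \<theta>)"
    unfolding s'_def node_def using s5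
    by (simp add: s1_def[symmetric] s2_def[symmetric] s3_def[symmetric] s4_def[symmetric] s5_def[symmetric]
        del: result.simps(11)) (simp add: fun_eq_iff)
  show "rmem s' a = rmem s a" if "a \<noteq> threshold_cell (length xs) \<pi>" "a \<noteq> answer_cell (length xs) \<pi>" "a \<noteq> scratch_cell (length xs)"
    using that by (simp add: s')
  have E: "?E \<subseteq> set xs" by (simp add: extreme_set_def)
  have "force_path xs (heavy_at (length xs) (rmem s')) \<pi> R = force_path xs ?hv \<pi> R" for R
    by (rule force_path_cong) (auto simp: heavy_at_def s')
  moreover have "force_path xs ?hv \<pi> ?E \<subseteq> set xs" "force_path xs ?hv (True # \<pi>) ?E \<subseteq> set xs"
    using l E by (intro force_path_subset; simp)+
  note this[THEN oracle_bound]
  then have "\<bar>u - f (force_path xs ?hv \<pi> ?E)\<bar> \<le> \<tau>" "\<bar>v - f (force_path xs ?hv (True # \<pi>) ?E)\<bar> \<le> \<tau>"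
    unfolding u_def v_def s2(2) s4(2) by blast+
  ultimately show "node_correct \<theta> (rmem s') \<pi>" by (simp add: node_correct_def s')
qed

lemma level_effect:
  fixes s :: "'a state" and \<theta>
  assumes "\<And>\<pi>. \<pi> \<in> set ps \<Longrightarrow> length \<pi> = l" "l < 2 * length xs"
  defines "s' \<equiv> result xs orc (seqs (map (node (length xs) \<theta>) ps)) s"
  shows "(\<forall>a. (\<forall>\<pi>\<in>set ps. a \<noteq> threshold_cell (length xs) \<pi> \<and> a \<noteq> answer_cell (length xs) \<pi>) \<longrightarrow> a \<noteq> scratch_cell (length xs) \<longrightarrow> rmem s' a = rmem s a)
    \<and> (\<forall>\<pi>\<in>set ps. node_correct \<theta> (rmem s') \<pi>)"
  unfolding s'_def using assms(1)
proof (induction ps arbitrary: s)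
  case (Cons \<pi> ps)
  define s1 where "s1 = result xs orc (node (length xs) \<theta> \<pi>) s"
  define s2 where "s2 = result xs orc (seqs (map (node (length xs) \<theta>) ps)) s1"
  have l: "length \<pi> = l" using Cons.prems by simp
  note s1 = node_effect[where \<pi> = \<pi> and \<theta> = \<theta> and s = s, folded s1_def, unfolded l, OF assms(2)]
  have s2: "\<And>a. (\<forall>\<pi>\<in>set ps. a \<noteq> threshold_cell (length xs) \<pi> \<and> a \<noteq> answer_cell (length xs) \<pi>) \<Longrightarrow> a \<noteq> scratch_cell (length xs) \<Longrightarrow> rmem s2 a = rmem s1 a"
    "\<And>\<sigma>. \<sigma> \<in> set ps \<Longrightarrow> node_correct \<theta> (rmem s2) \<sigma>"
    using Cons by (auto simp: s2_def)
  have "node_correct \<theta> (rmem s2) \<pi>"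
  proof (cases "\<pi> \<in> set ps")
    case False
    then have "node_correct \<theta> (rmem s2) \<pi> \<longleftrightarrow> node_correct \<theta> (rmem s1) \<pi>"
      using Cons.prems by (intro node_correct_cong) (auto intro!: s2(1))
    then show ?thesis using s1(2) by simp
  qed (use s2 in auto)
  then show ?case using s1(1) s2 by (auto simp: s1_def[symmetric] s2_def[symmetric])
qed simp

lemma tree_effect:
  fixes s :: "'a state" and \<theta> K
  assumes "L \<le> 2 * length xs"
  defines "s' \<equiv> result xs orc (tree_command (length xs) K \<theta> L) s"
  shows "(\<forall>a<(length xs). rmem s' a = rmem s a) \<and> (\<forall>l<L. \<forall>\<pi>\<in>set (paths K l). node_correct \<theta> (rmem s') \<pi>)"
  unfolding s'_def using assms(1)
proof (induction L)
  case 0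
  then show ?case by (simp add: tree_command_def)
next
  case (Suc L)
  define s1 where "s1 = result xs orc (tree_command (length xs) K \<theta> L) s"
  define s2 where "s2 = result xs orc (seqs (map (node (length xs) \<theta>) (paths K L))) s1"
  have s2_eq: "result xs orc (tree_command (length xs) K \<theta> (Suc L)) s = s2"
    by (simp add: tree_command_def s1_def s2_def)
  have s1: "\<And>a. a < length xs \<Longrightarrow> rmem s1 a = rmem s a"
    "\<And>l \<pi>. l < L \<Longrightarrow> \<pi> \<in> set (paths K l) \<Longrightarrow> node_correct \<theta> (rmem s1) \<pi>"
    using Suc by (auto simp: s1_def)
  have s2: "\<And>a. (\<forall>\<pi>\<in>set (paths K L). a \<noteq> threshold_cell (length xs) \<pi> \<and> a \<noteq> answer_cell (length xs) \<pi>) \<Longrightarrow> a \<noteq> scratch_cell (length xs) \<Longrightarrow> rmem s2 a = rmem s1 a"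
    "\<And>\<sigma>. \<sigma> \<in> set (paths K L) \<Longrightarrow> node_correct \<theta> (rmem s2) \<sigma>"
    using level_effect[where ps = "paths K L" and l = L and \<theta> = \<theta> and s = s1] Suc.prems by (auto simp: s2_def set_paths)
  have "node_correct \<theta> (rmem s2) \<pi>" if "l < L" "\<pi> \<in> set (paths K l)" for l \<pi>
  proof -
    have "node_correct \<theta> (rmem s2) \<pi> \<longleftrightarrow> node_correct \<theta> (rmem s1) \<pi>"
      using that by (intro node_correct_cong) (auto intro!: s2(1) simp: set_paths)
    then show ?thesis using s1(2) that by simp
  qed
  moreover have "rmem s2 a = rmem s a" if "a < length xs" for a
  proof -
    have "rmem s2 a = rmem s1 a"
      using that cells_ge[of "length xs"] by (intro s2(1)) (auto simp: leD)
    then show ?thesis using s1(1) that by simp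
  qed
  ultimately show ?case using s2(2) unfolding s2_eq by (auto simp: less_Suc_eq)
qed

lemma leaf_round_effect:
  fixes s :: "'a state" and k
  assumes l: "length \<pi> \<le> 2 * length xs"
  defines "s' \<equiv> result xs orc (leaf_round (length xs) \<pi> k) s"
  shows "same_outside_block (length xs) s s'"
    and "\<exists>v. rmem s' = (rmem s)(scratch_cell (length xs) := v, average_cell (length xs) \<pi> := rmem s (average_cell (length xs) \<pi>) + v) \<and>
      \<bar>v - f (force_path xs (heavy_at (length xs) (rmem s)) \<pi> (set_at xs s (sample_block (length xs) k)))\<bar> \<le> \<tau>"
proof -
  define s1 where "s1 = result xs orc (copy_sample (length xs) k) s"
  define s2 where "s2 = result xs orc (replay (length xs) \<pi>) s1"
  note s1 = copy_sample_effect[where k = k and s = s, folded s1_def]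
  have s2: "rmem s2 = rmem s" "same_outside_block (length xs) s s2"
    "set_at xs s2 (length xs) = force_path xs (heavy_at (length xs) (rmem s)) \<pi> (set_at xs s (sample_block (length xs) k))"
    using replay_effect[OF l, where s = s1, folded s2_def] s1 same_outside_block_trans by auto
  define v where "v = orc (queries s2) (set_at xs s2 (length xs))"
  have s': "rmem s' = (rmem s)(scratch_cell (length xs) := v, average_cell (length xs) \<pi> := rmem s (average_cell (length xs) \<pi>) + v)"
    "nmem s' = nmem s2"
    by (simp_all add: s'_def leaf_round_def s1_def[symmetric] s2_def[symmetric] s2(1) Let_def v_def fun_upd_twist)
  show "same_outside_block (length xs) s s'" using s2(2) s'(2) by (simp add: same_outside_block_def)
  have "\<bar>v - f (force_path xs (heavy_at (length xs) (rmem s)) \<pi> (set_at xs s (sample_block (length xs) k)))\<bar> \<le> \<tau>"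
    unfolding v_def s2(3) by (intro oracle_bound force_path_subset l set_at_subset)
  then show "\<exists>v. rmem s' = (rmem s)(scratch_cell (length xs) := v, average_cell (length xs) \<pi> := rmem s (average_cell (length xs) \<pi>) + v) \<and>
      \<bar>v - f (force_path xs (heavy_at (length xs) (rmem s)) \<pi> (set_at xs s (sample_block (length xs) k)))\<bar> \<le> \<tau>"
    using s'(1) by blast
qed

lemma set_at_sample_same_outside:
  "same_outside_block (length xs) s s' \<Longrightarrow> set_at xs s' (sample_block (length xs) k) = set_at xs s (sample_block (length xs) k)"
  by (intro set_at_cong) (simp add: same_outside_block_def sample_block_def)

text \<open>The oracle may push every answer in the same direction, so errors add up to
  \<open>real j * \<tau>\<close>; dividing by the number of rounds restores \<tau>.\<close>

lemma leaf_rounds_effect: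
  fixes s :: "'a state" and j
  assumes l: "length \<pi> \<le> 2 * length xs"
  defines "s' \<equiv> result xs orc (seqs (map (leaf_round (length xs) \<pi>) [0..<j])) s"
  shows "same_outside_block (length xs) s s' \<and>
    (\<forall>a. a \<noteq> scratch_cell (length xs) \<longrightarrow> a \<noteq> average_cell (length xs) \<pi> \<longrightarrow> rmem s' a = rmem s a) \<and>
    \<bar>rmem s' (average_cell (length xs) \<pi>) - rmem s (average_cell (length xs) \<pi>)
      - (\<Sum>k<j. f (force_path xs (heavy_at (length xs) (rmem s)) \<pi> (set_at xs s (sample_block (length xs) k))))\<bar> \<le> real j * \<tau>"
  unfolding s'_def
proof (induction j)
  case 0
  then show ?case by (simp add: same_outside_block_def)
next
  case (Suc j)
  define s1 where "s1 = result xs orc (seqs (map (leaf_round (length xs) \<pi>) [0..<j])) s"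
  define s2 where "s2 = result xs orc (leaf_round (length xs) \<pi> j) s1"
  have s2_eq: "result xs orc (seqs (map (leaf_round (length xs) \<pi>) [0..<Suc j])) s = s2"
    by (simp add: s1_def s2_def)
  note IH = Suc.IH[folded s1_def]
  have "heavy_at (length xs) (rmem s1) = heavy_at (length xs) (rmem s)" using IH by (simp add: heavy_at_def fun_eq_iff)
  moreover have "set_at xs s1 (sample_block (length xs) j) = set_at xs s (sample_block (length xs) j)"
    using IH set_at_sample_same_outside by blast
  ultimately obtain v where v: "rmem s2 = (rmem s1)(scratch_cell (length xs) := v, average_cell (length xs) \<pi> := rmem s1 (average_cell (length xs) \<pi>) + v)"
    "\<bar>v - f (force_path xs (heavy_at (length xs) (rmem s)) \<pi> (set_at xs s (sample_block (length xs) j)))\<bar> \<le> \<tau>"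
    using leaf_round_effect(2)[OF l, where k = j and s = s1, folded s2_def] by auto
  have "same_outside_block (length xs) s s2"
    using IH leaf_round_effect(1)[OF l, where s = s1 and k = j, folded s2_def] same_outside_block_trans by blast
  then show ?case unfolding s2_eq using IH v by (simp add: algebra_simps abs_le_iff)
qed

lemma leaf_effect:
  fixes s :: "'a state"
  assumes l: "length \<pi> \<le> 2 * length xs" and m: "0 < m"
  defines "s' \<equiv> result xs orc (leaf_command (length xs) m \<pi>) s"
  shows "same_outside_block (length xs) s s'"
    and "a \<noteq> scratch_cell (length xs) \<Longrightarrow> a \<noteq> average_cell (length xs) \<pi> \<Longrightarrow> rmem s' a = rmem s a"
    and "\<bar>rmem s' (average_cell (length xs) \<pi>)
      - (\<Sum>k<m. f (force_path xs (heavy_at (length xs) (rmem s)) \<pi> (set_at xs s (sample_block (length xs) k)))) / real m\<bar> \<le> \<tau>"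
proof -
  define s1 where "s1 = result xs orc (RConst (Direct (average_cell (length xs) \<pi>)) 0) s"
  define s2 where "s2 = result xs orc (seqs (map (leaf_round (length xs) \<pi>) [0..<m])) s1"
  have s1: "rmem s1 = (rmem s)(average_cell (length xs) \<pi> := 0)" "nmem s1 = nmem s" by (simp_all add: s1_def)
  have hv: "heavy_at (length xs) (rmem s1) = heavy_at (length xs) (rmem s)" by (simp add: heavy_at_def fun_eq_iff s1)
  have set: "set_at xs s1 b = set_at xs s b" for b by (intro set_at_cong) (simp add: s1)
  have s2: "same_outside_block (length xs) s s2"
    "\<And>a. a \<noteq> scratch_cell (length xs) \<Longrightarrow> a \<noteq> average_cell (length xs) \<pi> \<Longrightarrow> rmem s2 a = rmem s a"
    "\<bar>rmem s2 (average_cell (length xs) \<pi>)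
      - (\<Sum>k<m. f (force_path xs (heavy_at (length xs) (rmem s)) \<pi> (set_at xs s (sample_block (length xs) k))))\<bar> \<le> real m * \<tau>"
    using leaf_rounds_effect[OF l, where j = m and s = s1, folded s2_def] unfolding hv set
    by (auto simp: s1 same_outside_block_def)
  have s': "nmem s' = nmem s2"
    "rmem s' = (rmem s2)(scratch_cell (length xs) := real m, average_cell (length xs) \<pi> := rmem s2 (average_cell (length xs) \<pi>) / real m)"
    unfolding s'_def leaf_command_def
    by (simp_all add: s1_def[symmetric] s2_def[symmetric] fun_upd_twist del: result.simps(5))
       (simp_all add: fun_eq_iff)
  show "same_outside_block (length xs) s s'" using s2(1) s'(1) by (simp add: same_outside_block_def)
  show "rmem s' a = rmem s a" if "a \<noteq> scratch_cell (length xs)" "a \<noteq> average_cell (length xs) \<pi>"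
    using that s2(2) by (simp add: s'(2))
  show "\<bar>rmem s' (average_cell (length xs) \<pi>)
      - (\<Sum>k<m. f (force_path xs (heavy_at (length xs) (rmem s)) \<pi> (set_at xs s (sample_block (length xs) k)))) / real m\<bar> \<le> \<tau>"
    using s2(3) m by (simp add: s'(2) diff_divide_distrib[symmetric] abs_divide divide_le_eq mult.commute)
qed

lemma leaves_effect:
  fixes s :: "'a state"
  assumes "\<And>\<pi>. \<pi> \<in> set ps \<Longrightarrow> length \<pi> \<le> 2 * length xs" and m: "0 < m"
  defines "s' \<equiv> result xs orc (seqs (map (leaf_command (length xs) m) ps)) s"
  shows "same_outside_block (length xs) s s' \<and>
    (\<forall>a. (\<forall>\<pi>\<in>set ps. a \<noteq> average_cell (length xs) \<pi>) \<longrightarrow> a \<noteq> scratch_cell (length xs) \<longrightarrow> rmem s' a = rmem s a) \<and>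
    (\<forall>\<pi>\<in>set ps. \<bar>rmem s' (average_cell (length xs) \<pi>)
      - (\<Sum>k<m. f (force_path xs (heavy_at (length xs) (rmem s)) \<pi> (set_at xs s (sample_block (length xs) k)))) / real m\<bar> \<le> \<tau>)"
  unfolding s'_def using assms(1)
proof (induction ps arbitrary: s)
  case Nil
  then show ?case by (simp add: same_outside_block_def)
next
  case (Cons \<pi> ps)
  define s1 where "s1 = result xs orc (leaf_command (length xs) m \<pi>) s"
  define s2 where "s2 = result xs orc (seqs (map (leaf_command (length xs) m) ps)) s1"
  have "length \<pi> \<le> 2 * length xs" using Cons.prems by simp
  note s1 = leaf_effect[OF this m, where s = s, folded s1_def]
  have hv: "heavy_at (length xs) (rmem s1) = heavy_at (length xs) (rmem s)" using s1(2) by (simp add: heavy_at_def fun_eq_iff)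
  have set: "set_at xs s1 (sample_block (length xs) k) = set_at xs s (sample_block (length xs) k)" for k
    by (rule set_at_sample_same_outside[OF s1(1)])
  have IH: "same_outside_block (length xs) s1 s2"
    "\<And>a. (\<forall>\<pi>\<in>set ps. a \<noteq> average_cell (length xs) \<pi>) \<Longrightarrow> a \<noteq> scratch_cell (length xs) \<Longrightarrow> rmem s2 a = rmem s1 a"
    "\<And>\<sigma>. \<sigma> \<in> set ps \<Longrightarrow> \<bar>rmem s2 (average_cell (length xs) \<sigma>)
      - (\<Sum>k<m. f (force_path xs (heavy_at (length xs) (rmem s)) \<sigma> (set_at xs s (sample_block (length xs) k)))) / real m\<bar> \<le> \<tau>"
    using Cons.IH[of s1, folded s2_def] Cons.prems unfolding hv set by auto
  have "\<bar>rmem s2 (average_cell (length xs) \<pi>)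
      - (\<Sum>k<m. f (force_path xs (heavy_at (length xs) (rmem s)) \<pi> (set_at xs s (sample_block (length xs) k)))) / real m\<bar> \<le> \<tau>"
  proof (cases "\<pi> \<in> set ps")
    case False
    then have "rmem s2 (average_cell (length xs) \<pi>) = rmem s1 (average_cell (length xs) \<pi>)" by (intro IH(2)) auto
    then show ?thesis using s1(3) by simp
  qed (use IH in auto)
  then show ?case
    using s1(1,2) IH same_outside_block_trans[OF s1(1) IH(1)] by (auto simp: s1_def[symmetric] s2_def[symmetric])
qed

end

end

section \<open>The drawn blocks are independent samples from the product distribution\<close>

definition store_set :: "'a list \<Rightarrow> nat \<Rightarrow> nat \<Rightarrow> 'a set \<Rightarrow> 'a state \<Rightarrow> 'a state" where
  "store_set xs b j S s =
     s\<lparr>nmem := (\<lambda>a. if b \<le> a \<and> a < b + j then (if xs ! (a - b) \<in> S then 1 else 0) else nmem s a)\<rparr>"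

primrec store_sets :: "'a list \<Rightarrow> (nat \<Rightarrow> 'a set) \<Rightarrow> nat \<Rightarrow> 'a state \<Rightarrow> 'a state" where
  "store_sets xs r 0 s = s"
| "store_sets xs r (Suc m) s =
     store_set xs (sample_block (length xs) m) (length xs) (r m) (store_sets xs r m s)"

lemma rmem_store_set [simp]: "rmem (store_set xs b j S s) = rmem s"
  by (simp add: store_set_def)

lemma rmem_store_sets [simp]: "rmem (store_sets xs r m s) = rmem s"
  by (induction m) auto

lemma store_sets_upd: "m \<le> k \<Longrightarrow> store_sets xs (r(k := S)) m s = store_sets xs r m s"
  by (induction m) auto

lemma set_at_store_set: "S \<subseteq> set xs \<Longrightarrow> set_at xs (store_set xs b (length xs) S s) b = S"
  by (auto simp: set_at_def store_set_def in_set_conv_nth subset_iff)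

lemma set_at_store_sets:
  assumes "k < m" "r k \<subseteq> set xs"
  shows "set_at xs (store_sets xs r m s) (sample_block (length xs) k) = r k"
  using assms(1)
proof (induction m)
  case (Suc m)
  show ?case
  proof (cases "k = m")
    case True
    then show ?thesis using assms(2) by (simp add: set_at_store_set)
  next
    case False
    have "set_at xs (store_sets xs r (Suc m) s) (sample_block (length xs) k)
        = set_at xs (store_sets xs r m s) (sample_block (length xs) k)"
    proof (rule set_at_cong)
      fix i assume "i < length xs"
      moreover have "Suc k * length xs \<le> m * length xs" using False Suc.prems by (intro mult_right_mono) auto
      ultimately have "sample_block (length xs) k + i < sample_block (length xs) m"
        by (simp add: sample_block_def)
      then show "nmem (store_sets xs r (Suc m) s) (sample_block (length xs) k + i)
          = nmem (store_sets xs r m s) (sample_block (length xs) k + i)"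
        by (simp add: store_set_def)
    qed
    then show ?thesis using Suc False by simp
  qed
qed simp

text \<open>Stated for prefixes of the block to permit induction on the number of bits drawn;
  distinctness of \<open>xs\<close> keeps a new bit from concerning an earlier element.\<close>

lemma exec_draw_sample_prefix:
  assumes distinct: "distinct xs" and rmem: "\<And>i. i < length xs \<Longrightarrow> rmem s i = p (xs ! i)" and "j \<le> length xs"
  shows "exec xs orc (seqs (map (\<lambda>i. Bernoulli (Direct (b + i)) (Direct i)) [0..<j])) s
    = map_pmf (\<lambda>S. store_set xs b j S s) (product_distribution (set (take j xs)) p)"
  using assms(3)
proof (induction j)
  case 0
  have "(\<lambda>a. if b \<le> a \<and> a < b then z else nmem s a) = nmem s" for z by (auto simp: fun_eq_iff)
  then show ?case by (simp add: product_distribution_empty store_set_def if_distrib cong: if_cong)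
next
  case (Suc j)
  let ?x = "xs ! j" and ?D = "product_distribution (set (take j xs)) p"
  have x: "?x \<notin> set (take j xs)" "set (take (Suc j) xs) = insert ?x (set (take j xs))"
    using distinct Suc.prems by (auto simp: in_set_conv_nth nth_eq_iff_index_eq take_Suc_conv_app_nth)
  let ?upd = "\<lambda>t s'. nset (Direct (b + j)) (if t then 1 else 0) s' :: 'a state"
  have upd: "?upd t (store_set xs b j R s) = store_set xs b (Suc j) (if t then insert ?x R else R) s"
    if R: "R \<in> set_pmf ?D" for t R
  proof -
    have "R \<subseteq> set (take j xs)" using R set_product_distribution by blast
    then have "?x \<notin> R" using x by auto
    moreover have "xs ! i \<noteq> ?x" if "i < j" for i using that distinct Suc.prems by (auto simp: nth_eq_iff_index_eq)
    ultimately have "(\<lambda>a. if b \<le> a \<and> a < b + j then (if xs ! (a - b) \<in> R then 1 else 0) else nmem s a)(b + j := (if t then 1 else 0))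
        = (\<lambda>a. if b \<le> a \<and> a < b + Suc j then (if xs ! (a - b) \<in> (if t then insert ?x R else R) then 1 else 0) else nmem s a)"
      by (auto simp: fun_eq_iff less_Suc_eq)
    then show ?thesis by (simp add: store_set_def)
  qed
  have single: "exec xs orc (seqs [Bernoulli (Direct (b + j)) (Direct j)]) (store_set xs b j R s)
      = bind_pmf (bernoulli_pmf (p ?x)) (\<lambda>t. return_pmf (?upd t (store_set xs b j R s)))" for R
    using rmem[of j] Suc.prems
    by (simp add: map_pmf_def bind_assoc_pmf bind_return_pmf bind_return_pmf')
  have "exec xs orc (seqs (map (\<lambda>i. Bernoulli (Direct (b + i)) (Direct i)) [0..<Suc j])) s
      = bind_pmf ?D (\<lambda>R. bind_pmf (bernoulli_pmf (p ?x)) (\<lambda>t. return_pmf (?upd t (store_set xs b j R s))))"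
  proof -
    have "map (\<lambda>i. Bernoulli (Direct (b + i)) (Direct i)) [0..<Suc j]
        = map (\<lambda>i. Bernoulli (Direct (b + i)) (Direct i)) [0..<j] @ [Bernoulli (Direct (b + j)) (Direct j)]"
      by simp
    moreover have "j \<le> length xs" using Suc.prems by simp
    ultimately show ?thesis by (simp only: exec_seqs_append Suc.IH bind_map_pmf single)
  qed
  also have "\<dots> = bind_pmf ?D (\<lambda>R. bind_pmf (bernoulli_pmf (p ?x))
      (\<lambda>t. return_pmf (store_set xs b (Suc j) (if t then insert ?x R else R) s)))"
    by (intro bind_pmf_cong refl) (use upd in simp)
  \<comment> \<open>The program draws the new bit last, whereas
    \<open>product_distribution_insert\<close> draws it first; hence the exchange of the two
    draws.\<close>
  also have "\<dots> = map_pmf (\<lambda>S. store_set xs b (Suc j) S s) (product_distribution (set (take (Suc j) xs)) p)"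
    unfolding x(2) product_distribution_insert[OF finite_set x(1)]
    by (subst bind_commute_pmf) (simp add: map_pmf_def bind_assoc_pmf bind_return_pmf)
  finally show ?case .
qed

lemma exec_SKIP: "exec xs orc SKIP = return_pmf"
  by (rule ext) simp

lemma exec_sample_command:
  assumes "distinct xs" "\<And>i. i < length xs \<Longrightarrow> rmem s i = p (xs ! i)"
  shows "exec xs orc (sample_command (length xs) m) s
    = map_pmf (\<lambda>r. store_sets xs r m s) (iid_pmf m (product_distribution (set xs) p))"
proof (induction m)
  case 0
  show ?case by (simp add: sample_command_def)
next
  case (Suc m)
  let ?D = "product_distribution (set xs) p" and ?b = "sample_block (length xs) m"
  have single: "exec xs orc (seqs [draw_sample (length xs) ?b]) (store_sets xs r m s)
      = map_pmf (\<lambda>S. store_set xs ?b (length xs) S (store_sets xs r m s)) ?D" for r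
    using exec_draw_sample_prefix[OF assms(1), of "store_sets xs r m s" p "length xs" orc ?b] assms(2)
    by (simp add: draw_sample_def exec_SKIP bind_return_pmf' del: exec.simps(1))
  have "exec xs orc (sample_command (length xs) (Suc m)) s
      = bind_pmf (exec xs orc (sample_command (length xs) m) s) (exec xs orc (seqs [draw_sample (length xs) ?b]))"
    by (simp add: sample_command_def exec_seqs_append)
  also have "\<dots> = bind_pmf (iid_pmf m ?D) (\<lambda>r. map_pmf (\<lambda>S. store_set xs ?b (length xs) S (store_sets xs r m s)) ?D)"
    unfolding Suc bind_map_pmf single ..
  also have "\<dots> = map_pmf (\<lambda>r. store_sets xs r (Suc m) s) (iid_pmf (Suc m) ?D)"
    by (simp add: map_bind_pmf map_pmf_comp store_sets_upd)
  finally show ?case .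
qed

section \<open>The evaluator follows the branch of its argument\<close>

lemma flag_effect:
  fixes S :: "'a set" and s :: "'a state" and orc :: "'a answers"
  assumes l: "length \<pi> < 2 * length xs" and S: "\<And>i. i < length xs \<Longrightarrow> nmem s i \<noteq> 0 \<longleftrightarrow> xs ! i \<in> S"
  defines "s' \<equiv> result xs orc (flag_command (length xs) \<pi>) s"
  shows "rmem s' = rmem s" "\<And>i. i < length xs \<Longrightarrow> nmem s' i = nmem s i"
    and "nmem s' (2 * length xs) < nmem s' (2 * length xs + 1) \<longleftrightarrow>
      heavy_at (length xs) (rmem s) \<pi> \<and> (tested_element xs (length \<pi>) \<in> S \<longleftrightarrow> length \<pi> < length xs)"
proof -
  have pos: "position (length xs) (length \<pi>) < length xs" using l by (auto simp: position_def)
  have e: "tested_element xs (length \<pi>) \<in> S \<longleftrightarrow> nmem s (position (length xs) (length \<pi>)) > 0"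
    using S[OF pos] by (simp add: tested_element_def position_def)
  show "rmem s' = rmem s" "\<And>i. i < length xs \<Longrightarrow> nmem s' i = nmem s i"
    by (auto simp: s'_def flag_command_def)
  show "nmem s' (2 * length xs) < nmem s' (2 * length xs + 1) \<longleftrightarrow>
      heavy_at (length xs) (rmem s) \<pi> \<and> (tested_element xs (length \<pi>) \<in> S \<longleftrightarrow> length \<pi> < length xs)"
    using pos by (auto simp: e s'_def flag_command_def heavy_cond_def heavy_at_def)
qed

lemma count_branch_mono:
  "l \<le> l' \<Longrightarrow> count_list (branch xs hv S l) True \<le> count_list (branch xs hv S l') True"
  by (induction l' rule: dec_induct) auto

text \<open>Invariant: \<open>K\<close> is at least the number of \<open>True\<close> steps still to
  come. Once it is 0 the rest of the branch is forced to be \<open>False\<close>, so skipping the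
  tests is sound.\<close>

lemma eval_effect:
  fixes S :: "'a set" and s :: "'a state"
  assumes "\<And>i. i < length xs \<Longrightarrow> nmem s i \<noteq> 0 \<longleftrightarrow> xs ! i \<in> S"
    and hv: "heavy_at (length xs) (rmem s) = hv"
    and "l + k = 2 * length xs"
    and "count_list (branch xs hv S (2 * length xs)) True \<le> K + count_list (branch xs hv S l) True"
  shows "rmem (result xs orc (eval_command (length xs) K k (branch xs hv S l)) s) 0
    = rmem s (average_cell (length xs) (branch xs hv S (2 * length xs)))"
  using assms
proof (induction k arbitrary: K l s)
  case 0
  then show ?case by (simp add: average_cell_def)
next
  case (Suc k)
  let ?\<pi> = "branch xs hv S l"
  have mono: "count_list (branch xs hv S (Suc l)) True \<le> count_list (branch xs hv S (2 * length xs)) True"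
    using Suc.prems(3) by (intro count_branch_mono) simp
  show ?case
  proof (cases K)
    case 0
    then have "branch xs hv S (Suc l) = False # ?\<pi>" using mono Suc.prems(4) by (auto split: if_splits)
    moreover have "count_list (branch xs hv S (2 * length xs)) True \<le> 0 + count_list (branch xs hv S (Suc l)) True"
      using Suc.prems(4) 0 calculation by simp
    ultimately show ?thesis using Suc.IH[of s "Suc l" 0] Suc.prems 0 by (simp del: branch.simps)
  next
    case (Suc K')
    define s' where "s' = result xs orc (flag_command (length xs) ?\<pi>) s"
    have "length ?\<pi> < 2 * length xs" using Suc.prems(3) by simp
    note flag = flag_effect[OF this, where s = s and S = S and orc = orc, folded s'_def, OF Suc.prems(1)]
    define b where "b \<longleftrightarrow> nmem s' (2 * length xs) < nmem s' (2 * length xs + 1)"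
    have br: "branch xs hv S (Suc l) = b # ?\<pi>" using flag(3) Suc.prems(2) by (simp add: b_def)
    define K1 where "K1 = (if b then K' else K)"
    have "rmem (result xs orc (eval_command (length xs) K1 k (branch xs hv S (Suc l))) s') 0
        = rmem s' (average_cell (length xs) (branch xs hv S (2 * length xs)))"
    proof (rule Suc.IH)
      show "nmem s' i \<noteq> 0 \<longleftrightarrow> xs ! i \<in> S" if "i < length xs" for i using flag(2) Suc.prems(1) that by simp
      show "heavy_at (length xs) (rmem s') = hv" using flag(1) Suc.prems(2) by simp
      show "Suc l + k = 2 * length xs" using Suc.prems(3) by simp
      show "count_list (branch xs hv S (2 * length xs)) True \<le> K1 + count_list (branch xs hv S (Suc l)) True"
        using Suc.prems(4) Suc unfolding br K1_def by auto
    qed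
    moreover have "result xs orc (eval_command (length xs) K (Suc k) ?\<pi>) s
        = result xs orc (eval_command (length xs) K1 k (branch xs hv S (Suc l))) s'"
      unfolding br Suc by (simp add: s'_def[symmetric] b_def K1_def Suc)
    ultimately show ?thesis by (simp add: flag(1))
  qed
qed

section \<open>Error budget and success probability for general parameters\<close>

section \<open>Correctness of the learner\<close>

text \<open>\<open>d\<close>, \<epsilon> and \<tau> bound the distance of \<open>f\<close> from its
  leaf mean, the sampling error and the oracle error. \<open>c\<close> is the mass granted to
  arguments with a bad average, and \<delta> the probability that this mass is exceeded.\<close>

lemma learner_correct:
  fixes f :: "'a set \<Rightarrow> real" and K m :: nat and \<alpha> \<beta> \<delta> \<tau> \<kappa> \<epsilon> d c :: real
  defines "A \<equiv> \<lambda>n. Algorithm (learn_command n K (2 * \<tau> + \<kappa>) m) (eval_command n K (2 * n) [])"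
  assumes distinct: "distinct xs" and sub: "submodular_on (set xs) f"
    and f: "\<And>S. S \<subseteq> set xs \<Longrightarrow> f S \<in> {0..1}" and p: "\<And>x. x \<in> set xs \<Longrightarrow> p x \<in> {0..1}"
    and tol: "tolerant_oracle (set xs) f \<tau> orc"
    and pos: "0 < \<tau>" "0 < \<kappa>" "0 < \<epsilon>" "0 < d" "d \<le> 1" "0 < c" "0 < m"
    and K: "2 \<le> real K * \<kappa>"
    and error: "d + \<epsilon> + \<tau> \<le> \<alpha>"
    and tail: "2 * exp (- (3 * d\<^sup>2) / (16 * (4 * \<tau> + \<kappa>))) + c \<le> \<beta>"
    and m: "1 / (real m * \<epsilon>\<^sup>2) \<le> \<delta> * c"
    and t: "algorithm_length (A (length xs)) \<le> t"
  shows "outputs_function_within xs orc p t (A (length xs)) \<and>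
    success_probability xs orc p t (A (length xs)) (approximates (product_distribution (set xs) p) \<alpha> \<beta> f) \<ge> 1 - \<delta>"
proof -
  let ?n = "length xs" and ?U = "set xs" and ?D = "product_distribution (set xs) p"
  let ?ev = "eval_command ?n K (2 * ?n) []" and ?\<theta> = "2 * \<tau> + \<kappa>"
  \<comment> \<open>No random bit has been drawn yet, so this is a single state, and one instance of
    the tree serves all outcomes of the sampling.\<close>
  define s1 where "s1 = result xs orc (tree_command ?n K ?\<theta> (2 * ?n)) (initial_state xs p)"
  define hv where "hv = heavy_at ?n (rmem s1)"
  have tree: "\<And>a. a < ?n \<Longrightarrow> rmem s1 a = p (xs ! a)"
    "\<And>\<pi>. length \<pi> < 2 * ?n \<Longrightarrow> count_list \<pi> True \<le> K \<Longrightarrow> node_correct xs f \<tau> ?\<theta> (rmem s1) \<pi>"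
    using tree_effect[OF distinct tol, where L = "2 * ?n" and \<theta> = ?\<theta> and K = K and s = "initial_state xs p"]
    by (auto simp: s1_def set_paths initial_state_def)
  \<comment> \<open>Each of the two answers errs by at most \<tau>, so the threshold
    \<open>2 * \<tau> + \<kappa>\<close> leaves \<kappa> on the heavy side and
    \<open>4 * \<tau> + \<kappa>\<close> on the light side.\<close>
  interpret decision_tree xs f hv \<kappa> "4 * \<tau> + \<kappa>" K
  proof
    fix \<pi> :: "bool list" assume \<pi>: "length \<pi> < 2 * ?n" "count_list \<pi> True \<le> K"
    note correct = tree(2)[OF \<pi>, unfolded node_correct_def[OF distinct tol], folded hv_def]
    show "\<kappa> < f (force_path xs hv (True # \<pi>) (extreme_set xs (length \<pi>)))
        - f (force_path xs hv \<pi> (extreme_set xs (length \<pi>)))" if "hv \<pi>"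
      using that correct unfolding hv_def heavy_at_def by linarith
    show "f (force_path xs hv (True # \<pi>) (extreme_set xs (length \<pi>)))
        - f (force_path xs hv \<pi> (extreme_set xs (length \<pi>))) \<le> 4 * \<tau> + \<kappa>" if "\<not> hv \<pi>"
      using that correct unfolding hv_def heavy_at_def by linarith
  qed (use sub f pos K in auto)
  define fin where "fin r = result xs orc (seqs (map (leaf_command ?n m) (paths K (2 * ?n)))) (store_sets xs r m s1)" for r
  define h where "h r S = rmem (fin r) (average_cell ?n (br S (2 * ?n)))" for r S
  have sample: "exec xs orc (sample_command ?n m) s1 = map_pmf (\<lambda>r. store_sets xs r m s1) (iid_pmf m ?D)"
    by (intro exec_sample_command distinct tree(1))
  have exec_learn: "exec xs orc (learn_command ?n K ?\<theta> m) (initial_state xs p) = map_pmf fin (iid_pmf m ?D)"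
    unfolding learn_command_def exec.simps exec_deterministic[OF deterministic_tree] bind_return_pmf
      s1_def[symmetric] sample bind_map_pmf
    by (simp add: exec_deterministic fin_def[abs_def] map_pmf_def)
  have learn: "learning_result xs orc p t (A ?n) = map_pmf (\<lambda>r. (SKIP, fin r)) (iid_pmf m ?D)"
    using t unfolding learning_result_def A_def algorithm.sel
    by (subst run_eq_exec) (auto simp: loop_free_learn algorithm_length_def exec_learn map_pmf_comp)
  have leaf_in: "br S (2 * ?n) \<in> set (paths K (2 * ?n))" if "S \<subseteq> ?U" for S
    using count_branch[OF that] by (simp add: set_paths)
  \<comment> \<open>The answers may depend on the random sets through the query history; whatever
    they are, they move an average by at most \<tau>.\<close>
  have fin: "heavy_at ?n (rmem (fin r)) = hv"
    "\<And>\<pi>. \<pi> \<in> set (paths K (2 * ?n)) \<Longrightarrow> \<bar>rmem (fin r) (average_cell ?n \<pi>)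
      - (\<Sum>k<m. f (force_path xs hv \<pi> (r k))) / real m\<bar> \<le> \<tau>" if r: "r \<in> set_pmf (iid_pmf m ?D)" for r
  proof -
    have "r k \<subseteq> ?U" if "k < m" for k using iid_pmf_in[OF r that] set_product_distribution by blast
    then have set: "set_at xs (store_sets xs r m s1) (sample_block ?n k) = r k" if "k < m" for k
      using that by (intro set_at_store_sets)
    note leaves = leaves_effect[OF distinct tol, where ps = "paths K (2 * ?n)" and m = m and s = "store_sets xs r m s1", folded fin_def,
        unfolded rmem_store_sets, folded hv_def]
    show "heavy_at ?n (rmem (fin r)) = hv"
      using leaves pos by (simp add: set_paths hv_def heavy_at_def fun_eq_iff)
    show "\<bar>rmem (fin r) (average_cell ?n \<pi>) - (\<Sum>k<m. f (force_path xs hv \<pi> (r k))) / real m\<bar> \<le> \<tau>"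
      if "\<pi> \<in> set (paths K (2 * ?n))" for \<pi>
      using leaves pos that set by (simp add: set_paths)
  qed
  have rep: "represents xs orc t ?ev (fin r) (h r)" if r: "r \<in> set_pmf (iid_pmf m ?D)" for r
    unfolding represents_def
  proof (intro conjI query_free_eval allI impI exI)
    fix S assume S: "S \<subseteq> ?U"
    have det: "deterministic ?ev" by (rule deterministic_eval)
    show "run xs orc t (?ev, load_set xs S (fin r)) = return_pmf (SKIP, result xs orc ?ev (load_set xs S (fin r)))"
      using t by (subst run_eq_exec)
        (auto simp: loop_free_if_deterministic[OF det] exec_deterministic[OF det] A_def algorithm_length_def)
    show "rmem (result xs orc ?ev (load_set xs S (fin r))) 0 = h r S"
      using eval_effect[of xs "load_set xs S (fin r)" S hv 0 "2 * ?n" K orc] fin(1)[OF r] count_branch[OF S, of "2 * ?n"]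
      by (simp add: load_set_def h_def)
  qed
  have outputs: "outputs_function_within xs orc p t (A ?n)"
    unfolding outputs_function_within_def learn using rep by (auto simp: A_def)
  \<comment> \<open>Uses exact values of \<open>f\<close>, so that for fixed \<open>T\<close> this
    is an event about independent samples alone.\<close>
  define Q where "Q r T \<longleftrightarrow> \<bar>(\<Sum>k<m. f (res (br T (2 * ?n)) (r k))) / real m - leaf_mean p T\<bar> > \<epsilon>" for r T
  have finD: "finite (set_pmf ?D)" by (simp add: finite_product_distribution)
  have "measure_pmf.prob (iid_pmf m ?D) {r. Q r T} \<le> \<delta> * c" if "T \<in> set_pmf ?D" for T
  proof -
    have T: "T \<subseteq> ?U" using that set_product_distribution by blast
    have "f (res (br T (2 * ?n)) S) \<in> {0..1}" if "S \<in> set_pmf ?D" for S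
      using that set_product_distribution[of ?U p] by (intro range res_br_subset[OF T]) blast
    from prob_average_iid_far[where g = "\<lambda>R. f (res (br T (2 * ?n)) R)", OF finD this pos(3) pos(7)] m
    show ?thesis unfolding Q_def leaf_mean_def by linarith
  qed
  from prob_prob_large[OF finite_iid_pmf[OF finD] finD pos(6) this]
  have few: "measure_pmf.prob (iid_pmf m ?D) {r. c < measure_pmf.prob ?D {T. Q r T}} \<le> \<delta>"
    using pos by simp
  have good: "approximates ?D \<alpha> \<beta> f (h r)" if r: "r \<in> set_pmf (iid_pmf m ?D)" and c: "measure_pmf.prob ?D {T. Q r T} \<le> c" for r
  proof -
    let ?far = "{T. \<bar>f T - leaf_mean p T\<bar> > d}" and ?bad = "{S. \<not> \<bar>f S - h r S\<bar> \<le> \<alpha>}"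
    have "\<bar>f T - h r T\<bar> \<le> \<alpha>" if "T \<subseteq> ?U" "T \<notin> ?far" "\<not> Q r T" for T
      using fin(2)[OF r leaf_in[OF that(1)]] that(2,3) error unfolding h_def Q_def by simp
    then have "?bad \<inter> set_pmf ?D \<subseteq> ?far \<union> {T. Q r T}" using set_product_distribution by blast
    have "measure_pmf.prob ?D ?bad = measure_pmf.prob ?D (?bad \<inter> set_pmf ?D)"
      by (simp add: measure_Int_set_pmf)
    also have "\<dots> \<le> measure_pmf.prob ?D (?far \<union> {T. Q r T})"
      using \<open>?bad \<inter> set_pmf ?D \<subseteq> _\<close> by (intro measure_pmf.finite_measure_mono) auto
    also have "\<dots> \<le> measure_pmf.prob ?D ?far + measure_pmf.prob ?D {T. Q r T}"
      by (rule measure_Un_le) auto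
    also have "\<dots> \<le> \<beta>" using prob_far_from_leaf_mean[where p = p, OF p pos(4,5)] c tail by linarith
    finally have "measure_pmf.prob ?D ?bad \<le> \<beta>" .
    moreover have "{S. \<bar>f S - h r S\<bar> \<le> \<alpha>} = UNIV - ?bad" by auto
    ultimately show ?thesis
      unfolding approximates_def using measure_pmf.prob_compl[of ?bad ?D] by simp
  qed
  have "1 - \<delta> \<le> measure_pmf.prob (iid_pmf m ?D) {r. measure_pmf.prob ?D {T. Q r T} \<le> c}"
  proof -
    have "{r. measure_pmf.prob ?D {T. Q r T} \<le> c} = UNIV - {r. c < measure_pmf.prob ?D {T. Q r T}}" by auto
    then show ?thesis
      using measure_pmf.prob_compl[of "{r. c < measure_pmf.prob ?D {T. Q r T}}" "iid_pmf m ?D"] few by simp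
  qed
  also have "\<dots> = measure_pmf.prob (iid_pmf m ?D) ({r. measure_pmf.prob ?D {T. Q r T} \<le> c} \<inter> set_pmf (iid_pmf m ?D))"
    by (simp add: measure_Int_set_pmf)
  also have "\<dots> \<le> success_probability xs orc p t (A ?n) (approximates ?D \<alpha> \<beta> f)"
    unfolding success_probability_def learn measure_map_pmf using rep good
    by (intro measure_pmf.finite_measure_mono) (auto simp: A_def)
  finally show ?thesis using outputs by simp
qed

section \<open>Choice of the constants and the exponent of the running time\<close>

section \<open>Running time\<close>

text \<open>\<open>W\<close> dominates every monomial of the length bounds: 6 + 18 + 2 + 21
  multiples of it for the learner and 20 for the evaluator.\<close>

lemma algorithm_length_le:
  assumes "1 \<le> m"
  shows "algorithm_length (Algorithm (learn_command n K \<theta> m) (eval_command n K (2 * n) []))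
    \<le> 67 * (m * Suc (2 * n) ^ (K + 2))"
proof -
  define P where "P = Suc (2 * n) ^ K"
  define b where "b = Suc (2 * n)"
  define W where "W = m * P * b\<^sup>2"
  have P: "1 \<le> P" and b: "1 \<le> b" "2 * n \<le> b" by (simp_all add: P_def b_def)
  have le: "x * y * z \<le> W" if "x \<le> m" "y \<le> P" "z \<le> b\<^sup>2" for x y z
    unfolding W_def using that by (intro mult_le_mono)
  have b2: "1 \<le> b\<^sup>2" "b \<le> b\<^sup>2" using b by (simp_all add: power2_eq_square)
  have W: "1 \<le> W" "b \<le> W" "P * b \<le> W" "P * b\<^sup>2 \<le> W" "m * b \<le> W" "P \<le> W" "m * P * b \<le> W"
    using le[of 1 1 1] le[of 1 1 b] le[of 1 P b] le[of 1 P "b\<^sup>2"] le[of m 1 b] le[of 1 P 1] le[of m P b] assms P b2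
    by simp_all
  have "2 * n * (2 + P * (16 + 10 * n)) \<le> b * (2 + P * (16 * b))"
    using b by (intro mult_le_mono add_le_mono le_refl) (simp_all add: b_def)
  also have "\<dots> = 2 * b + 16 * (P * b\<^sup>2)" by (simp add: algebra_simps power2_eq_square)
  finally have 1: "2 * n * (2 + P * (16 + 10 * n)) \<le> 18 * W" using W by linarith
  have "m * (2 + 2 * n) \<le> m * (2 * b)" by (intro mult_le_mono) (simp_all add: b_def)
  then have 2: "m * (2 + 2 * n) \<le> 2 * W" using W by linarith
  have "P * (11 + m * (10 + 12 * n)) \<le> P * (11 + m * (10 * b))" by (intro mult_le_mono add_le_mono) (simp_all add: b_def)
  also have "\<dots> = 11 * P + 10 * (m * P * b)" by (simp add: algebra_simps)
  finally have 3: "P * (11 + m * (10 + 12 * n)) \<le> 21 * W" using W by linarith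
  have "com_length (eval_command n K (2 * n) []) \<le> 20 * (P * b)"
    using com_length_eval[of n K "2 * n" "[]"] by (simp add: P_def b_def algebra_simps)
  then have 4: "com_length (eval_command n K (2 * n) []) \<le> 20 * W" using W by linarith
  have "com_length (learn_command n K \<theta> m) \<le> 6 + 18 * W + 2 * W + 21 * W"
    using com_length_learn[of n K \<theta> m] 1 2 3 unfolding P_def by linarith
  then have "algorithm_length (Algorithm (learn_command n K \<theta> m) (eval_command n K (2 * n) [])) \<le> 67 * W"
    using 4 W by (simp add: algorithm_length_def)
  also have "W = m * Suc (2 * n) ^ (K + 2)" by (simp only: W_def P_def b_def power_add mult.assoc)
  finally show ?thesis .
qed

lemma log_inv_ge: "1 / 2 \<le> log_inv \<beta>" if "0 < \<beta>"
proof -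
  have "1 / 2 \<le> ln (2 :: real)" using ln_2_less_1 ln2_ge_two_thirds by simp
  also have "\<dots> \<le> log_inv \<beta>" unfolding log_inv_def using that by (intro ln_mono) (auto simp: field_simps min_def)
  finally show ?thesis .
qed

lemma exp_log_inv: "0 < \<beta> \<Longrightarrow> exp (- log_inv \<beta>) = min \<beta> (1 / 2)"
  by (simp add: log_inv_def ln_div exp_minus)

text \<open>The surplus of 3/2 in the exponent is worth a factor of at most 2^(-3/2) < 3/8, because
  \<open>exp (- L) \<le> 1 / 2\<close>. This is where freezing the logarithm at \<beta> = 1/2
  enters. A quarter of \<open>exp (- L)\<close> remains for bad averages.\<close>

lemma tail_le:
  fixes L y :: real
  assumes "exp (- L) \<le> 1 / 2" "5 / 2 * L \<le> y"
  shows "2 * exp (- y) \<le> 3 / 4 * exp (- L)"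
proof -
  define u where "u = exp (- (L / 2))"
  have u: "0 < u" "u\<^sup>2 = exp (- L)" by (simp_all add: u_def power2_eq_square exp_add[symmetric])
  have "u ^ 3 \<le> 3 / 8"
  proof (rule power2_le_imp_le)
    have "(u ^ 3)\<^sup>2 = (u\<^sup>2) ^ 3" by (simp add: power_mult[symmetric] mult.commute)
    also have "\<dots> \<le> (1 / 2) ^ 3" using assms(1) u by (intro power_mono) auto
    finally show "(u ^ 3)\<^sup>2 \<le> (3 / 8)\<^sup>2" by (simp add: power2_eq_square power3_eq_cube)
  qed simp
  have "exp (- y) \<le> exp (- (5 / 2 * L))" using assms(2) by simp
  also have "\<dots> = u ^ 3 * exp (- L)"
    by (simp add: u_def exp_of_nat_mult[symmetric] exp_add[symmetric])
  also have "\<dots> \<le> 3 / 8 * exp (- L)" using \<open>u ^ 3 \<le> 3 / 8\<close> by (intro mult_right_mono) auto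
  finally show ?thesis by simp
qed

text \<open>As \<open>B \<ge> 2\<close> and \<open>X \<ge> 1 / 2\<close>, every factor becomes a
  power of \<open>B\<close> with exponent a multiple of \<open>X\<close>: 14 for the constant,
  \<open>2 * D + 6\<close> for \<open>m\<close>, and 1746 = 3 * 576 + 18 for the power of
  \<open>Suc (2 * n) \<le> B ^ 3\<close>.\<close>

lemma time_bound:
  fixes L \<alpha> \<delta> :: real and n :: nat
  assumes L: "1 / 2 \<le> L" and \<alpha>: "0 < \<alpha>" "\<alpha> \<le> 1" and \<delta>: "0 < \<delta>"
  defines "K \<equiv> nat \<lceil>576 * L / \<alpha>\<^sup>2\<rceil>" and "m \<equiv> nat \<lceil>1600 * exp L / (\<alpha>\<^sup>2 * \<delta>)\<rceil>"
    and "B \<equiv> real (max 2 n)"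
  shows "real (67 * (m * Suc (2 * n) ^ (K + 2)))
    \<le> B powr ((1766 + 2 * log 2 (1600 / \<delta> + 1)) * (L / \<alpha>\<^sup>2))"
proof -
  define X where "X = L / \<alpha>\<^sup>2"
  have a2: "0 < \<alpha>\<^sup>2" "\<alpha>\<^sup>2 \<le> 1" using \<alpha> by (auto simp: power_le_one)
  have LX: "L \<le> X" unfolding X_def using a2 L by (simp add: le_divide_eq mult_left_le)
  then have X: "1 / 2 \<le> X" using L by simp
  have B: "2 \<le> B" by (simp add: B_def)
  have powr_mono_B: "2 powr x \<le> B powr y" if "0 \<le> x" "x \<le> y" for x y
    using B that by (intro order_trans[OF powr_mono2 powr_mono]) auto
  have 1: "67 \<le> B powr (14 * X)" using powr_mono_B[of 7 "14 * X"] X by simp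
  define D where "D = log 2 (1600 / \<delta> + 1)"
  have D: "0 \<le> D" "1600 / \<delta> + 1 = 2 powr D" using \<delta> by (simp_all add: D_def add_pos_pos)
  have "1600 / \<delta> + 1 \<le> B powr (2 * D * X)"
    unfolding D(2) using D(1) X mult_left_mono[of 1 "2 * X" D] by (intro powr_mono_B) auto
  moreover have exp_le: "exp y \<le> B powr (2 * y)" if "0 \<le> y" for y
  proof -
    have "exp y \<le> exp (2 * y * ln 2)" using mult_left_mono[of 1 "2 * ln 2" y] that ln2_ge_two_thirds by (simp add: mult_ac)
    also have "\<dots> = 2 powr (2 * y)" by (simp add: powr_def)
    also have "\<dots> \<le> B powr (2 * y)" using that by (intro powr_mono_B) auto
    finally show ?thesis .
  qed
  have "exp L \<le> exp X" using LX by simp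
  with exp_le[of X] X have "exp L \<le> B powr (2 * X)" by linarith
  moreover have "1 / \<alpha>\<^sup>2 \<le> B powr (4 * X)"
  proof -
    have "1 / \<alpha>\<^sup>2 \<le> 2 * X" unfolding X_def using L a2 by (simp add: divide_right_mono)
    also have "\<dots> \<le> exp (2 * X)" using exp_ge_add_one_self[of "2 * X"] by linarith
    also have "\<dots> \<le> B powr (4 * X)" using exp_le[of "2 * X"] X by simp
    finally show ?thesis .
  qed
  ultimately have "(1600 / \<delta> + 1) * exp L * (1 / \<alpha>\<^sup>2) \<le> B powr (2 * D * X) * B powr (2 * X) * B powr (4 * X)"
    using \<delta> a2 by (intro mult_mono) auto
  moreover have "real m \<le> (1600 / \<delta> + 1) * exp L * (1 / \<alpha>\<^sup>2)"
  proof -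
    have "0 \<le> 1600 * exp L / (\<alpha>\<^sup>2 * \<delta>)" using \<delta> a2 by simp
    then have "real m \<le> 1600 * exp L / (\<alpha>\<^sup>2 * \<delta>) + 1" unfolding m_def by linarith
    also have "1 \<le> exp L / \<alpha>\<^sup>2" using L a2 by (simp add: le_divide_eq order_trans[OF a2(2)])
    finally show ?thesis using \<delta> a2 by (simp add: field_simps)
  qed
  ultimately have 2: "real m \<le> B powr ((2 * D + 6) * X)"
    by (simp add: powr_add[symmetric] algebra_simps)
  have "real (Suc (2 * n)) \<le> B ^ 3"
  proof (cases "n \<le> 2")
    case True
    then have "B = 2" by (simp add: B_def)
    then show ?thesis using True by simp
  next
    case False
    then have B_n: "B = real n" by (simp add: B_def)
    have "2 * n + 1 \<le> n * 3" using False by simp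
    also have "\<dots> \<le> n * (n * n)" using False mult_le_mono[of 2 n 2 n] by (intro mult_le_mono) auto
    finally have "real (2 * n + 1) \<le> real (n * (n * n))" by (rule of_nat_mono)
    then show ?thesis by (simp add: B_n power3_eq_cube mult.assoc)
  qed
  then have "real (Suc (2 * n)) ^ (K + 2) \<le> (B ^ 3) ^ (K + 2)" by (intro power_mono) auto
  also have "\<dots> = B powr (3 * (real K + 2))"
    using powr_realpow[of B "3 * (K + 2)"] B by (simp only: power_mult[symmetric]) (simp add: algebra_simps)
  also have "\<dots> \<le> B powr (1746 * X)"
  proof -
    have "0 \<le> 576 * L / \<alpha>\<^sup>2" using L a2 by simp
    then have "real K \<le> 576 * L / \<alpha>\<^sup>2 + 1" unfolding K_def by linarith
    then have "real K \<le> 576 * X + 1" by (simp add: X_def)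
    then show ?thesis using B X by (intro powr_mono) auto
  qed
  finally have "67 * (real m * real (Suc (2 * n)) ^ (K + 2))
      \<le> B powr (14 * X) * (B powr ((2 * D + 6) * X) * B powr (1746 * X))"
    using 1 2 by (intro mult_mono) auto
  also have "\<dots> = B powr ((1766 + 2 * D) * X)" by (simp add: powr_add[symmetric] algebra_simps)
  finally show ?thesis unfolding X_def D_def of_nat_mult of_nat_power of_nat_numeral .
qed

theorem theorem3p5:
  fixes \<delta> :: real
  assumes "0 < \<delta>"
  shows "\<exists>C>0. \<forall>(U :: 'a set) \<alpha> \<beta> :: real.
    finite U \<longrightarrow> \<alpha> \<in> {0<..1} \<longrightarrow> \<beta> \<in> {0<..1} \<longrightarrow>
    (\<exists>(A :: algorithm) (t :: nat).
       real t \<le> real (max 2 (card U)) powr (C * (log_inv \<beta> / \<alpha>\<^sup>2)) \<and>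
       algorithm_length A \<le> t \<and>
       (\<forall>(f :: 'a set \<Rightarrow> real) (p :: 'a \<Rightarrow> real) (xs :: 'a list) (orc :: 'a answers).
          submodular_on U f \<longrightarrow> (\<forall>S \<subseteq> U. f S \<in> {0..1}) \<longrightarrow>
          (\<forall>x \<in> U. p x \<in> {0..1}) \<longrightarrow>
          distinct xs \<longrightarrow> set xs = U \<longrightarrow>
          tolerant_oracle U f (\<alpha>\<^sup>2 / (72 * log_inv \<beta>)) orc \<longrightarrow>
          outputs_function_within xs orc p t A \<and>
          success_probability xs orc p t A (approximates (product_distribution U p) \<alpha> \<beta> f)
            \<ge> 1 - \<delta>))"
proof (intro exI[of _ "1766 + 2 * log 2 (1600 / \<delta> + 1)"] conjI allI impI)
  \<comment> \<open>\<delta> is chosen before the constant, so its share of the sample size goes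
    into the exponent.\<close>
  have "0 \<le> log 2 (1600 / \<delta> + 1)" using assms by (simp add: add_pos_pos)
  then show "0 < 1766 + 2 * log 2 (1600 / \<delta> + 1)" by simp
  fix U :: "'a set" and \<alpha> \<beta> :: real
  assume "finite U" and \<alpha>: "\<alpha> \<in> {0<..1}" and \<beta>: "\<beta> \<in> {0<..1}"
  define L where "L = log_inv \<beta>"
  define \<tau> where "\<tau> = \<alpha>\<^sup>2 / (72 * L)"
  \<comment> \<open>\<open>2 / (\<tau> / 4)\<close> rounded up: two rises of at most 1, in portions
    of at least \<open>\<tau> / 4\<close>.\<close>
  define K where "K = nat \<lceil>576 * L / \<alpha>\<^sup>2\<rceil>"
  \<comment> \<open>Solves the Chebyshev condition
    \<open>1 / (m * \<epsilon>\<^sup>2) \<le> \<delta> * c\<close> for \<epsilon> = \<alpha>/20 and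
    \<open>c = exp (- L) / 4\<close>, as 400 * 4 = 1600.\<close>
  define m where "m = nat \<lceil>1600 * exp L / (\<alpha>\<^sup>2 * \<delta>)\<rceil>"
  define A where "A n = Algorithm (learn_command n K (2 * \<tau> + \<tau> / 4) m) (eval_command n K (2 * n) [])" for n
  have L: "1 / 2 \<le> L" and exp_L: "exp (- L) = min \<beta> (1 / 2)"
    using \<beta> log_inv_ge exp_log_inv by (auto simp: L_def)
  have \<tau>: "0 < \<tau>" using \<alpha> L by (simp add: \<tau>_def)
  have m_pos: "0 < 1600 * exp L / (\<alpha>\<^sup>2 * \<delta>)" using \<alpha> assms by simp
  then have m: "1600 * exp L / (\<alpha>\<^sup>2 * \<delta>) \<le> real m" "0 < m" unfolding m_def by linarith+
  have \<alpha>2: "\<alpha>\<^sup>2 \<le> \<alpha>" using \<alpha> by (simp add: power2_eq_square mult_left_le)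
  have "\<tau> \<le> \<alpha> / 36"
  proof -
    have "\<tau> \<le> \<alpha> / (72 * (1 / 2))" unfolding \<tau>_def using L \<alpha> \<alpha>2 by (intro frac_le) auto
    then show ?thesis by simp
  qed
  \<comment> \<open>9/10 + 1/20 + 1/36 < 1; the last term is available because
    \<open>L \<ge> 1 / 2\<close>.\<close>
  then have error: "9 / 10 * \<alpha> + \<alpha> / 20 + \<tau> \<le> \<alpha>" using \<alpha> by simp
  have "576 * L / \<alpha>\<^sup>2 \<le> real K" unfolding K_def by linarith
  then have "576 * L / \<alpha>\<^sup>2 * (\<tau> / 4) \<le> real K * (\<tau> / 4)" using \<tau> by (intro mult_right_mono) auto
  moreover have "576 * L / \<alpha>\<^sup>2 * (\<tau> / 4) = 2" using \<alpha> L by (simp add: \<tau>_def)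
  ultimately have K: "2 \<le> real K * (\<tau> / 4)" by simp
  \<comment> \<open>The right-hand side equals (3 * 0.81 * 72 / 68) times \<open>L\<close>, about
    2.57 times \<open>L\<close>, where 68 = 16 * 17/4.\<close>
  have "5 / 2 * L \<le> 3 * (9 / 10 * \<alpha>)\<^sup>2 / (16 * (4 * \<tau> + \<tau> / 4))"
    using \<alpha> L by (simp add: \<tau>_def power2_eq_square field_simps)
  from tail_le[OF _ this] have "2 * exp (- (3 * (9 / 10 * \<alpha>)\<^sup>2) / (16 * (4 * \<tau> + \<tau> / 4))) \<le> 3 / 4 * exp (- L)"
    unfolding exp_L by simp
  then have tail: "2 * exp (- (3 * (9 / 10 * \<alpha>)\<^sup>2) / (16 * (4 * \<tau> + \<tau> / 4))) + exp (- L) / 4 \<le> \<beta>"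
    using exp_L by linarith
  have samples: "1 / (real m * (\<alpha> / 20)\<^sup>2) \<le> \<delta> * (exp (- L) / 4)"
  proof -
    have "1600 * exp L \<le> real m * (\<alpha>\<^sup>2 * \<delta>)" using m \<alpha> assms by (simp add: divide_le_eq)
    then show ?thesis using m \<alpha> assms by (simp add: exp_minus field_simps power2_eq_square)
  qed
  show "\<exists>(A :: algorithm) (t :: nat).
       real t \<le> real (max 2 (card U)) powr ((1766 + 2 * log 2 (1600 / \<delta> + 1)) * (log_inv \<beta> / \<alpha>\<^sup>2)) \<and>
       algorithm_length A \<le> t \<and>
       (\<forall>(f :: 'a set \<Rightarrow> real) (p :: 'a \<Rightarrow> real) (xs :: 'a list) (orc :: 'a answers).
          submodular_on U f \<longrightarrow> (\<forall>S \<subseteq> U. f S \<in> {0..1}) \<longrightarrow>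
          (\<forall>x \<in> U. p x \<in> {0..1}) \<longrightarrow>
          distinct xs \<longrightarrow> set xs = U \<longrightarrow>
          tolerant_oracle U f (\<alpha>\<^sup>2 / (72 * log_inv \<beta>)) orc \<longrightarrow>
          outputs_function_within xs orc p t A \<and>
          success_probability xs orc p t A (approximates (product_distribution U p) \<alpha> \<beta> f)
            \<ge> 1 - \<delta>)"
  \<comment> \<open>The length itself serves as the time bound, for both the learner and the
    evaluator, since both are loop-free.\<close>
  proof (intro exI[of _ "A (card U)"] exI[of _ "algorithm_length (A (card U))"] conjI allI impI order_refl)
    have "real (algorithm_length (A (card U))) \<le> real (67 * (m * Suc (2 * card U) ^ (K + 2)))"
      unfolding A_def of_nat_le_iff using m by (intro algorithm_length_le) auto
    also have "\<dots> \<le> real (max 2 (card U)) powr ((1766 + 2 * log 2 (1600 / \<delta> + 1)) * (L / \<alpha>\<^sup>2))"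
      unfolding K_def m_def using L \<alpha> assms by (intro time_bound) auto
    finally show "real (algorithm_length (A (card U)))
        \<le> real (max 2 (card U)) powr ((1766 + 2 * log 2 (1600 / \<delta> + 1)) * (log_inv \<beta> / \<alpha>\<^sup>2))"
      by (simp add: L_def)
  next
    fix f :: "'a set \<Rightarrow> real" and p :: "'a \<Rightarrow> real" and xs :: "'a list" and orc :: "'a answers"
    assume "submodular_on U f" "\<forall>S\<subseteq>U. f S \<in> {0..1}" "\<forall>x\<in>U. p x \<in> {0..1}" "distinct xs" "set xs = U"
      and "tolerant_oracle U f (\<alpha>\<^sup>2 / (72 * log_inv \<beta>)) orc"
    moreover from this have "length xs = card U" using distinct_card by fastforce
    ultimately have "outputs_function_within xs orc p (algorithm_length (A (card U))) (A (card U)) \<and>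
        success_probability xs orc p (algorithm_length (A (card U))) (A (card U))
          (approximates (product_distribution U p) \<alpha> \<beta> f) \<ge> 1 - \<delta>"
      using learner_correct[where xs = xs and f = f and p = p and orc = orc and \<tau> = \<tau> and \<kappa> = "\<tau> / 4"
          and \<epsilon> = "\<alpha> / 20" and d = "9 / 10 * \<alpha>" and c = "exp (- L) / 4" and m = m and K = K and \<alpha> = \<alpha>
          and \<beta> = \<beta> and \<delta> = \<delta> and t = "algorithm_length (A (card U))", folded A_def]
        K error tail samples \<tau> m \<alpha> by (simp add: \<tau>_def[symmetric] L_def[symmetric])
    then show "outputs_function_within xs orc p (algorithm_length (A (card U))) (A (card U))"
      "1 - \<delta> \<le> success_probability xs orc p (algorithm_length (A (card U))) (A (card U))
          (approximates (product_distribution U p) \<alpha> \<beta> f)" by auto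
  qed
qed

end
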